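(* The first eigenvalue of the Dirichlet Laplacian in the V-shaped waveguide $\Omega_\alpha$ satisfies $$\lambda_1(\mathcal{A}^{\Omega_\alpha})\to\pi^2\qquad\text{as }\alpha\to\pi/2,\ \alpha\in(0,\pi/2).$$
   Context: For a domain $\Omega$, let $H_0^1(\Omega)$ be the Sobolev space of $H^1(\Omega)$ functions with zero trace on $\partial\Omega$. The Dirichlet Laplacian $\mathcal{A}^{\Omega}$ is the self-adjoint operator in $L_2(\Omega)$ generated by the closed positive form $\mathfrak{a}_\Omega[u,v]=(\nabla u,\nabla v)_{L_2(\Omega)}$ with domain $H_0^1(\Omega)$. For $\alpha\in(0,\pi/2)$ the broken (V-shaped) waveguide $\Omega_\alpha\subset\mathbb{R}^2$ of unit width is the set of points inside a planar angle of magnitude $2\alpha$ whose distance to the boundary of the angle is less than one. In Cartesian coordinates $(x,z)$ with the vertex at the origin and the symmetry axis along the $z$-axis, $\Omega_\alpha=\{(x,z):0<z\sin\alpha-|x|\cos\alpha<1\}$. For every $\alpha\in(0,\pi/2)$ the essential spectrum of $\mathcal{A}^{\Omega_\alpha}$ is $[\pi^2,+\infty)$, and it is known that the discrete spectrum below $\pi^2$ is nonempty and finite; $\lambda_1(\mathcal{A}^{\Omega_\alpha})$ is its smallest element. *)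

theory Defs
  imports "HOL-Analysis.Analysis"
begin

text \<open>
  Elements of \<open>L\<^sub>2(\<Omega>)\<close> are represented by complex-valued functions on the whole space; only their
  values on \<open>\<Omega>\<close> matter, and functions that agree almost everywhere on \<open>\<Omega>\<close> represent the same element.
\<close>

definition L2 :: "'a::euclidean_space set \<Rightarrow> ('a \<Rightarrow> complex) set" where
  "L2 \<Omega> = {u. u \<in> borel_measurable (lebesgue_on \<Omega>) \<and>
              integrable (lebesgue_on \<Omega>) (\<lambda>x. (cmod (u x))\<^sup>2)}"

definition L2_inner ::
    "'a::euclidean_space set \<Rightarrow> ('a \<Rightarrow> complex) \<Rightarrow> ('a \<Rightarrow> complex) \<Rightarrow> complex" where
  "L2_inner \<Omega> u v = integral\<^sup>L (lebesgue_on \<Omega>) (\<lambda>x. u x * cnj (v x))"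

definition L2_norm :: "'a::euclidean_space set \<Rightarrow> ('a \<Rightarrow> complex) \<Rightarrow> real" where
  "L2_norm \<Omega> u = sqrt (integral\<^sup>L (lebesgue_on \<Omega>) (\<lambda>x. (cmod (u x))\<^sup>2))"

abbreviation partial :: "'a::euclidean_space \<Rightarrow> ('a \<Rightarrow> complex) \<Rightarrow> 'a \<Rightarrow> complex" where
  "partial b f \<equiv> (\<lambda>x. frechet_derivative f (at x) b)"

primrec C_k :: "nat \<Rightarrow> ('a::euclidean_space \<Rightarrow> complex) \<Rightarrow> bool" where
  "C_k 0 f \<longleftrightarrow> continuous_on UNIV f"
| "C_k (Suc k) f \<longleftrightarrow> (\<forall>x. f differentiable (at x)) \<and> (\<forall>b\<in>Basis. C_k k (partial b f))"

definition test_functions :: "'a::euclidean_space set \<Rightarrow> ('a \<Rightarrow> complex) set" where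
  "test_functions \<Omega> = {\<phi>. (\<forall>k. C_k k \<phi>) \<and>
     compact (closure {x. \<phi> x \<noteq> 0}) \<and> closure {x. \<phi> x \<noteq> 0} \<subseteq> \<Omega>}"

definition has_weak_partial ::
    "'a::euclidean_space set \<Rightarrow> 'a \<Rightarrow> ('a \<Rightarrow> complex) \<Rightarrow> ('a \<Rightarrow> complex) \<Rightarrow> bool" where
  "has_weak_partial \<Omega> b u g \<longleftrightarrow>
     (\<forall>\<phi>\<in>test_functions \<Omega>.
        integral\<^sup>L (lebesgue_on \<Omega>) (\<lambda>x. u x * partial b \<phi> x) =
        - integral\<^sup>L (lebesgue_on \<Omega>) (\<lambda>x. g x * \<phi> x))"

definition H1 :: "'a::euclidean_space set \<Rightarrow> ('a \<Rightarrow> complex) set" where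
  "H1 \<Omega> = {u \<in> L2 \<Omega>. \<forall>b\<in>Basis. \<exists>g\<in>L2 \<Omega>. has_weak_partial \<Omega> b u g}"

text \<open>
  On an open set the weak derivative of an \<open>H\<^sup>1\<close> function is unique up to a null set, so the choice
  below is immaterial.
\<close>

definition weak_partial ::
    "'a::euclidean_space set \<Rightarrow> 'a \<Rightarrow> ('a \<Rightarrow> complex) \<Rightarrow> 'a \<Rightarrow> complex" where
  "weak_partial \<Omega> b u = (SOME g. g \<in> L2 \<Omega> \<and> has_weak_partial \<Omega> b u g)"

text \<open>
  Zero trace is understood in the usual sense that makes no regularity demand on the boundary:
  \<open>H\<^sub>0\<^sup>1(\<Omega>)\<close> is the closure of the test functions in the norm of \<open>H\<^sup>1(\<Omega>)\<close>.
\<close>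

definition H01 :: "'a::euclidean_space set \<Rightarrow> ('a \<Rightarrow> complex) set" where
  "H01 \<Omega> = {u \<in> H1 \<Omega>. \<exists>\<phi>. (\<forall>n::nat. \<phi> n \<in> test_functions \<Omega>) \<and>
     (\<lambda>n. L2_norm \<Omega> (\<lambda>x. u x - \<phi> n x)) \<longlonglongrightarrow> 0 \<and>
     (\<forall>b\<in>Basis. (\<lambda>n. L2_norm \<Omega> (\<lambda>x. weak_partial \<Omega> b u x - partial b (\<phi> n) x)) \<longlonglongrightarrow> 0)}"

definition Dirichlet_form ::
    "'a::euclidean_space set \<Rightarrow> ('a \<Rightarrow> complex) \<Rightarrow> ('a \<Rightarrow> complex) \<Rightarrow> complex" where
  "Dirichlet_form \<Omega> u v = (\<Sum>b\<in>Basis. L2_inner \<Omega> (weak_partial \<Omega> b u) (weak_partial \<Omega> b v))"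

text \<open>
  Unbounded operators in \<open>L\<^sub>2(\<Omega>)\<close> are given by their graphs. The operator generated by a closed form
  \<open>a\<close> sends \<open>u\<close> to \<open>f\<close> iff \<open>a[u,v] = (f,v)\<close> for every \<open>v\<close> in the form domain.
\<close>

definition Dirichlet_Laplacian ::
    "'a::euclidean_space set \<Rightarrow> (('a \<Rightarrow> complex) \<times> ('a \<Rightarrow> complex)) set" where
  "Dirichlet_Laplacian \<Omega> = {(u, f). u \<in> H01 \<Omega> \<and> f \<in> L2 \<Omega> \<and>
     (\<forall>v\<in>H01 \<Omega>. Dirichlet_form \<Omega> u v = L2_inner \<Omega> f v)}"

text \<open>
  \<open>A - z\<close> maps the domain of \<open>A\<close> onto \<open>L\<^sub>2(\<Omega>)\<close> and has a bounded inverse; the estimate includes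
  injectivity.
\<close>

definition resolvent_set ::
    "'a::euclidean_space set \<Rightarrow> (('a \<Rightarrow> complex) \<times> ('a \<Rightarrow> complex)) set \<Rightarrow> complex set" where
  "resolvent_set \<Omega> A = {z.
     (\<forall>g\<in>L2 \<Omega>. \<exists>(u, f)\<in>A. AE x in lebesgue_on \<Omega>. f x - z * u x = g x) \<and>
     (\<exists>C. \<forall>(u, f)\<in>A. L2_norm \<Omega> u \<le> C * L2_norm \<Omega> (\<lambda>x. f x - z * u x))}"

definition spectrum ::
    "'a::euclidean_space set \<Rightarrow> (('a \<Rightarrow> complex) \<times> ('a \<Rightarrow> complex)) set \<Rightarrow> complex set" where
  "spectrum \<Omega> A = - resolvent_set \<Omega> A"

definition eigenspace ::
    "'a::euclidean_space set \<Rightarrow> (('a \<Rightarrow> complex) \<times> ('a \<Rightarrow> complex)) set \<Rightarrow> complex \<Rightarrow>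
      ('a \<Rightarrow> complex) set" where
  "eigenspace \<Omega> A z = {u. \<exists>f. (u, f) \<in> A \<and> (AE x in lebesgue_on \<Omega>. f x = z * u x)}"

definition is_eigenvalue ::
    "'a::euclidean_space set \<Rightarrow> (('a \<Rightarrow> complex) \<times> ('a \<Rightarrow> complex)) set \<Rightarrow> complex \<Rightarrow> bool" where
  "is_eigenvalue \<Omega> A z \<longleftrightarrow> (\<exists>u\<in>eigenspace \<Omega> A z. \<not> (AE x in lebesgue_on \<Omega>. u x = 0))"

definition finite_multiplicity ::
    "'a::euclidean_space set \<Rightarrow> (('a \<Rightarrow> complex) \<times> ('a \<Rightarrow> complex)) set \<Rightarrow> complex \<Rightarrow> bool" where
  "finite_multiplicity \<Omega> A z \<longleftrightarrow>
     (\<exists>B. finite B \<and> B \<subseteq> eigenspace \<Omega> A z \<and>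
        (\<forall>u\<in>eigenspace \<Omega> A z. \<exists>c. AE x in lebesgue_on \<Omega>. u x = (\<Sum>e\<in>B. c e * e x)))"

text \<open>
  The discrete spectrum consists of the isolated points of the spectrum that are eigenvalues of finite
  multiplicity. It is taken as a set of reals, since the operators considered are self-adjoint.
\<close>

definition discrete_spectrum ::
    "'a::euclidean_space set \<Rightarrow> (('a \<Rightarrow> complex) \<times> ('a \<Rightarrow> complex)) set \<Rightarrow> real set" where
  "discrete_spectrum \<Omega> A = {l. complex_of_real l isolated_in spectrum \<Omega> A \<and>
     is_eigenvalue \<Omega> A (complex_of_real l) \<and> finite_multiplicity \<Omega> A (complex_of_real l)}"

definition is_first_eigenvalue ::
    "'a::euclidean_space set \<Rightarrow> (('a \<Rightarrow> complex) \<times> ('a \<Rightarrow> complex)) set \<Rightarrow> real \<Rightarrow> bool" where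
  "is_first_eigenvalue \<Omega> A l \<longleftrightarrow>
     l \<in> discrete_spectrum \<Omega> A \<and> (\<forall>m\<in>discrete_spectrum \<Omega> A. l \<le> m)"

definition V_waveguide :: "real \<Rightarrow> (real \<times> real) set" where
  "V_waveguide \<alpha> = {(x, z). 0 < z * sin \<alpha> - \<bar>x\<bar> * cos \<alpha> \<and> z * sin \<alpha> - \<bar>x\<bar> * cos \<alpha> < 1}"

end

theory Submission
  imports Defs
begin

text \<open>
  The limit follows by squeezing: \<open>pi\<^sup>2 sin\<^sup>2 \<alpha> \<le> \<lambda>\<^sub>1 < pi\<^sup>2\<close> for every angle, and the left side tends to
  \<open>pi\<^sup>2\<close> as \<open>\<alpha> \<rightarrow> pi/2\<close>.

  For the left inequality, cut the waveguide along the lines \<open>x = const\<close>. Each line meets it in a single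
  interval, of length \<open>1 / sin \<alpha>\<close>, so the one-dimensional inequality of Wirtinger
  (\<open>Wirtinger_inequality\<close>) and Fubini's theorem bound \<open>\<parallel>\<partial>\<^sub>z u\<parallel>\<close> from below by \<open>pi sin \<alpha> \<parallel>u\<parallel>\<close> for test
  functions, hence on \<open>H\<^sub>0\<^sup>1\<close>. Evaluating the form at an eigenfunction gives the bound for every
  eigenvalue (\<open>eigenvalue_ge\<close>).

  For the right inequality it suffices that \<open>[pi\<^sup>2, \<infinity>)\<close> lies in the spectrum, since a point of the
  discrete spectrum is isolated (\<open>discrete_spectrum_less\<close>). This is Weyl's argument. Far out on the
  right branch the waveguide is a straight strip of unit width that carries the waves
  \<open>exp (i k s) sin (pi t)\<close>, where \<open>s\<close> and \<open>t\<close> are the coordinates along and across it. Multiplied by an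
  envelope of length \<open>n\<close>, such a wave solves the eigenvalue equation for \<open>k\<^sup>2 + pi\<^sup>2\<close> up to an error of
  order \<open>1/n\<close> on a region of area of order \<open>n\<close>, so the error tends to zero in \<open>L\<^sub>2\<close> while the norm of
  the packet does not; no bounded resolvent can exist (\<open>above_threshold_in_spectrum\<close>).

  The technical part is to place these packets in the domain of the operator. They do not vanish near
  the boundary, so they have to be approximated by test functions in \<open>H\<^sup>1\<close>: cutting off at distance
  \<open>1/m\<close> costs a derivative of size \<open>m\<close>, which the linear decay of the sine at the walls compensates
  (\<open>sin_cutoff_deriv_le\<close>). Moreover, the weak derivatives in the form are chosen arbitrarily among all
  admissible functions, so they have to be identified with the classical ones; this is the fundamental
  lemma of the calculus of variations (\<open>orthogonal_to_test_functions_imp_AE_0\<close>). All test functions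
  that occur explicitly are built from the single function \<open>exp (-1/y)\<close>.
\<close>

section \<open>Square-integrable functions\<close>

lemma L2_measurable: "u \<in> L2 \<Omega> \<Longrightarrow> u \<in> borel_measurable (lebesgue_on \<Omega>)"
  by (simp add: L2_def)

lemma L2_integrable: "u \<in> L2 \<Omega> \<Longrightarrow> integrable (lebesgue_on \<Omega>) (\<lambda>x. (cmod (u x))\<^sup>2)"
  by (simp add: L2_def)

lemma L2_norm_nonneg: "0 \<le> L2_norm \<Omega> u"
  by (simp add: L2_norm_def)

lemma L2_norm_square: "(L2_norm \<Omega> u)\<^sup>2 = (\<integral>x. (cmod (u x))\<^sup>2 \<partial>lebesgue_on \<Omega>)"
  by (simp add: L2_norm_def)

lemma L2_norm_cong_AE:
  assumes "u \<in> L2 \<Omega>" "v \<in> L2 \<Omega>" "AE x in lebesgue_on \<Omega>. u x = v x"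
  shows "L2_norm \<Omega> u = L2_norm \<Omega> v"
proof -
  have "(\<integral>x. (cmod (u x))\<^sup>2 \<partial>lebesgue_on \<Omega>) = (\<integral>x. (cmod (v x))\<^sup>2 \<partial>lebesgue_on \<Omega>)"
  proof (rule integral_cong_AE)
    show "AE x in lebesgue_on \<Omega>. (cmod (u x))\<^sup>2 = (cmod (v x))\<^sup>2"
      using assms(3) by eventually_elim simp
  qed (use assms(1,2)[THEN L2_measurable] in measurable)
  then show ?thesis by (simp add: L2_norm_def)
qed

lemma L2_add:
  assumes "u \<in> L2 \<Omega>" "v \<in> L2 \<Omega>"
  shows "(\<lambda>x. u x + v x) \<in> L2 \<Omega>"
proof -
  have [measurable]: "u \<in> borel_measurable (lebesgue_on \<Omega>)" "v \<in> borel_measurable (lebesgue_on \<Omega>)"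
    using assms[THEN L2_measurable] .
  have bound: "(cmod (a + b))\<^sup>2 \<le> 2 * (cmod a)\<^sup>2 + 2 * (cmod b)\<^sup>2" for a b :: complex
  proof -
    have "(cmod (a + b))\<^sup>2 \<le> (cmod a + cmod b)\<^sup>2"
      by (simp add: norm_triangle_ineq power_mono)
    also have "\<dots> \<le> 2 * (cmod a)\<^sup>2 + 2 * (cmod b)\<^sup>2"
      using sum_squares_bound[of "cmod a" "cmod b"] by (simp add: power2_sum)
    finally show ?thesis .
  qed
  have "integrable (lebesgue_on \<Omega>) (\<lambda>x. (cmod (u x + v x))\<^sup>2)"
    by (rule Bochner_Integration.integrable_bound
        [where f = "\<lambda>x. 2 * (cmod (u x))\<^sup>2 + 2 * (cmod (v x))\<^sup>2"])
       (use assms[THEN L2_integrable] bound in auto)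
  then show ?thesis by (simp add: L2_def)
qed

lemma L2_cmult: "u \<in> L2 \<Omega> \<Longrightarrow> (\<lambda>x. c * u x) \<in> L2 \<Omega>"
  by (auto simp: L2_def norm_mult power_mult_distrib)

lemma L2_diff: "u \<in> L2 \<Omega> \<Longrightarrow> v \<in> L2 \<Omega> \<Longrightarrow> (\<lambda>x. u x - v x) \<in> L2 \<Omega>"
  using L2_add[of u \<Omega> "\<lambda>x. -1 * v x"] L2_cmult[of v \<Omega> "-1"] by simp

text \<open>Young's inequality \<open>2|ab| \<le> |a|\<^sup>2 + |b|\<^sup>2\<close> makes products integrable.\<close>
lemma L2_mult_integrable:
  assumes "u \<in> L2 \<Omega>" "v \<in> L2 \<Omega>"
  shows "integrable (lebesgue_on \<Omega>) (\<lambda>x. u x * v x)"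
proof -
  have [measurable]: "u \<in> borel_measurable (lebesgue_on \<Omega>)" "v \<in> borel_measurable (lebesgue_on \<Omega>)"
    using assms[THEN L2_measurable] .
  have bound: "cmod (a * b) \<le> norm ((cmod a)\<^sup>2 + (cmod b)\<^sup>2)" for a b :: complex
  proof -
    have "2 * (cmod a * cmod b) \<le> (cmod a)\<^sup>2 + (cmod b)\<^sup>2"
      using sum_squares_bound[of "cmod a" "cmod b"] by simp
    moreover have "0 \<le> cmod a * cmod b" by simp
    ultimately show ?thesis unfolding norm_mult real_norm_def by linarith
  qed
  show ?thesis
    by (rule Bochner_Integration.integrable_bound[where f = "\<lambda>x. (cmod (u x))\<^sup>2 + (cmod (v x))\<^sup>2"])
       (use assms[THEN L2_integrable] bound in auto)
qed

lemma L2_cnj: "u \<in> L2 \<Omega> \<Longrightarrow> (\<lambda>x. cnj (u x)) \<in> L2 \<Omega>"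
  unfolding L2_def using borel_measurable_continuous_on[OF continuous_on_cnj[OF continuous_on_id], of u]
  by auto

lemma L2_inner_integrable:
  "u \<in> L2 \<Omega> \<Longrightarrow> v \<in> L2 \<Omega> \<Longrightarrow> integrable (lebesgue_on \<Omega>) (\<lambda>x. u x * cnj (v x))"
  using L2_mult_integrable[OF _ L2_cnj] .

lemma L2_inner_self: "L2_inner \<Omega> u u = complex_of_real ((L2_norm \<Omega> u)\<^sup>2)"
  unfolding L2_inner_def L2_norm_square complex_norm_square[symmetric]
  by (rule integral_complex_of_real)

lemma L2_Cauchy_Schwarz:
  assumes "u \<in> L2 \<Omega>" "v \<in> L2 \<Omega>"
  shows "cmod (L2_inner \<Omega> u v) \<le> L2_norm \<Omega> u * L2_norm \<Omega> v"
proof -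
  let ?M = "lebesgue_on \<Omega>"
  have [measurable]: "u \<in> borel_measurable ?M" "v \<in> borel_measurable ?M"
    using assms[THEN L2_measurable] .
  have int: "integrable ?M (\<lambda>x. cmod (u x) * cmod (v x))"
    using integrable_norm[OF L2_inner_integrable[OF assms]] by (simp add: norm_mult)
  have nn: "(\<integral>\<^sup>+x. ennreal ((cmod (f x))\<^sup>2) \<partial>?M) = ennreal ((L2_norm \<Omega> f)\<^sup>2)" if "f \<in> L2 \<Omega>" for f
    unfolding L2_norm_square
    using nn_integral_eq_integral[OF L2_integrable[OF that]] by (simp add: ennreal_power)
  have "(\<integral>\<^sup>+x. ennreal (cmod (u x)) * ennreal (cmod (v x)) \<partial>?M)\<^sup>2 \<le>
      (\<integral>\<^sup>+x. (ennreal (cmod (u x)))\<^sup>2 \<partial>?M) * (\<integral>\<^sup>+x. (ennreal (cmod (v x)))\<^sup>2 \<partial>?M)"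
    by (rule Cauchy_Schwarz_nn_integral) measurable
  also have "(\<integral>\<^sup>+x. ennreal (cmod (u x)) * ennreal (cmod (v x)) \<partial>?M)
      = ennreal (\<integral>x. cmod (u x) * cmod (v x) \<partial>?M)"
    using nn_integral_eq_integral[OF int] by (simp add: ennreal_mult')
  finally have "ennreal ((\<integral>x. cmod (u x) * cmod (v x) \<partial>?M)\<^sup>2) \<le>
      ennreal ((L2_norm \<Omega> u)\<^sup>2 * (L2_norm \<Omega> v)\<^sup>2)"
    by (simp add: nn assms ennreal_power ennreal_mult')
  then have "(\<integral>x. cmod (u x) * cmod (v x) \<partial>?M)\<^sup>2 \<le> (L2_norm \<Omega> u * L2_norm \<Omega> v)\<^sup>2"
    by (subst (asm) ennreal_le_iff) (auto simp: power_mult_distrib)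
  then have "(\<integral>x. cmod (u x) * cmod (v x) \<partial>?M) \<le> L2_norm \<Omega> u * L2_norm \<Omega> v"
    by (rule power2_le_imp_le) (simp add: L2_norm_nonneg)
  moreover have "cmod (L2_inner \<Omega> u v) \<le> (\<integral>x. cmod (u x) * cmod (v x) \<partial>?M)"
    unfolding L2_inner_def
    using integral_norm_bound[of ?M "\<lambda>x. u x * cnj (v x)"] by (simp add: norm_mult)
  ultimately show ?thesis by linarith
qed

lemma L2_inner_diff_right:
  assumes "u \<in> L2 \<Omega>" "v \<in> L2 \<Omega>" "w \<in> L2 \<Omega>"
  shows "L2_inner \<Omega> u (\<lambda>x. v x - w x) = L2_inner \<Omega> u v - L2_inner \<Omega> u w"
  unfolding L2_inner_def
  using L2_inner_integrable[OF assms(1,2)] L2_inner_integrable[OF assms(1,3)]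
  by (simp add: right_diff_distrib)

lemma L2_inner_tendsto_right:
  assumes "u \<in> L2 \<Omega>" "v \<in> L2 \<Omega>" "\<And>n. w n \<in> L2 \<Omega>"
    and "(\<lambda>n. L2_norm \<Omega> (\<lambda>x. v x - w n x)) \<longlonglongrightarrow> 0"
  shows "(\<lambda>n. L2_inner \<Omega> u (w n)) \<longlonglongrightarrow> L2_inner \<Omega> u v"
proof -
  have "(\<lambda>n. L2_inner \<Omega> u v - L2_inner \<Omega> u (w n)) \<longlonglongrightarrow> 0"
  proof (rule Lim_null_comparison)
    show "(\<lambda>n. L2_norm \<Omega> u * L2_norm \<Omega> (\<lambda>x. v x - w n x)) \<longlonglongrightarrow> 0"
      using tendsto_mult_right_zero[OF assms(4)] .
    show "\<forall>\<^sub>F n in sequentially. cmod (L2_inner \<Omega> u v - L2_inner \<Omega> u (w n))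
        \<le> L2_norm \<Omega> u * L2_norm \<Omega> (\<lambda>x. v x - w n x)"
      using L2_Cauchy_Schwarz[OF assms(1) L2_diff[OF assms(2,3)]]
      by (simp add: L2_inner_diff_right assms)
  qed
  from tendsto_diff[OF tendsto_const[of "L2_inner \<Omega> u v"] this] show ?thesis by simp
qed

lemma L2_norm_triangle:
  assumes "u \<in> L2 \<Omega>" "v \<in> L2 \<Omega>"
  shows "L2_norm \<Omega> u \<le> L2_norm \<Omega> v + L2_norm \<Omega> (\<lambda>x. u x - v x)"
proof (cases "L2_norm \<Omega> u = 0")
  case False
  have conj: "L2_inner \<Omega> u v = L2_inner \<Omega> u u - L2_inner \<Omega> u (\<lambda>x. u x - v x)"
    by (simp add: L2_inner_diff_right assms)
  have "(L2_norm \<Omega> u)\<^sup>2 = cmod (L2_inner \<Omega> u u)"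
    unfolding L2_inner_self norm_of_real by simp
  also have "\<dots> \<le> cmod (L2_inner \<Omega> u v) + cmod (L2_inner \<Omega> u (\<lambda>x. u x - v x))"
    using norm_triangle_ineq[of "L2_inner \<Omega> u v" "L2_inner \<Omega> u (\<lambda>x. u x - v x)"] conj by simp
  also have "\<dots> \<le> L2_norm \<Omega> u * L2_norm \<Omega> v + L2_norm \<Omega> u * L2_norm \<Omega> (\<lambda>x. u x - v x)"
    by (intro add_mono L2_Cauchy_Schwarz L2_diff assms)
  finally have "L2_norm \<Omega> u * L2_norm \<Omega> u
      \<le> L2_norm \<Omega> u * (L2_norm \<Omega> v + L2_norm \<Omega> (\<lambda>x. u x - v x))"
    by (simp add: power2_eq_square distrib_left)
  then show ?thesis
    using False L2_norm_nonneg[of \<Omega> u] by (simp add: mult_le_cancel_left)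
qed (simp add: L2_norm_nonneg)

lemma L2_norm_minus_commute: "L2_norm \<Omega> (\<lambda>x. u x - v x) = L2_norm \<Omega> (\<lambda>x. v x - u x)"
  by (simp add: L2_norm_def norm_minus_commute)

lemma L2_norm_tendsto:
  assumes "u \<in> L2 \<Omega>" "\<And>n. w n \<in> L2 \<Omega>"
    and lim: "(\<lambda>n. L2_norm \<Omega> (\<lambda>x. u x - w n x)) \<longlonglongrightarrow> 0"
  shows "(\<lambda>n. L2_norm \<Omega> (w n)) \<longlonglongrightarrow> L2_norm \<Omega> u"
proof -
  have "(\<lambda>n. L2_norm \<Omega> (w n) - L2_norm \<Omega> u) \<longlonglongrightarrow> 0"
  proof (rule Lim_null_comparison[OF _ lim])
    show "\<forall>\<^sub>F n in sequentially. norm (L2_norm \<Omega> (w n) - L2_norm \<Omega> u)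
        \<le> L2_norm \<Omega> (\<lambda>x. u x - w n x)"
    proof (rule always_eventually, rule allI)
      fix n
      show "norm (L2_norm \<Omega> (w n) - L2_norm \<Omega> u) \<le> L2_norm \<Omega> (\<lambda>x. u x - w n x)"
        using L2_norm_triangle[OF assms(1,2), of n] L2_norm_triangle[OF assms(2,1), of n]
        by (simp add: L2_norm_minus_commute[of \<Omega> u] abs_le_iff)
    qed
  qed
  then show ?thesis by (simp add: LIM_zero_iff)
qed

text \<open>
  The regular functions below are Borel measurable on the whole space, and then integrals over \<open>\<Omega>\<close>
  for Lebesgue measure are integrals for Borel--Lebesgue measure, where Fubini's theorem is
  available.
\<close>

lemma integral_lebesgue_on_eq_lborel:
  fixes f :: "'a::euclidean_space \<Rightarrow> 'b::{banach, second_countable_topology}"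
  assumes "open \<Omega>" "f \<in> borel_measurable borel"
  shows "integral\<^sup>L (lebesgue_on \<Omega>) f = (\<integral>x. indicator \<Omega> x *\<^sub>R f x \<partial>lborel)"
    and "integrable (lebesgue_on \<Omega>) f \<longleftrightarrow> integrable lborel (\<lambda>x. indicator \<Omega> x *\<^sub>R f x)"
proof -
  have \<Omega>: "\<Omega> \<in> sets borel" using assms(1) by simp
  then have L: "\<Omega> \<inter> space lebesgue \<in> sets lebesgue" by simp
  have [measurable]: "(\<lambda>x. indicator \<Omega> x *\<^sub>R f x) \<in> borel_measurable lborel"
    using \<Omega> assms(2) by measurable
  show "integral\<^sup>L (lebesgue_on \<Omega>) f = (\<integral>x. indicator \<Omega> x *\<^sub>R f x \<partial>lborel)"
    by (simp add: integral_restrict_space[OF L] integral_completion)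
  show "integrable (lebesgue_on \<Omega>) f \<longleftrightarrow> integrable lborel (\<lambda>x. indicator \<Omega> x *\<^sub>R f x)"
    by (simp add: integrable_restrict_space[OF L] integrable_completion)
qed

lemma integrable_bounded_support:
  fixes f :: "'a::euclidean_space \<Rightarrow> 'b::{banach, second_countable_topology}"
  assumes "f \<in> borel_measurable borel" "bounded {x. f x \<noteq> 0}" "\<And>x. norm (f x) \<le> K"
  shows "integrable lborel f"
proof -
  obtain a b where ab: "{x. f x \<noteq> 0} \<subseteq> cbox a b"
    using bounded_subset_cbox_symmetric[OF assms(2)] by blast
  have "integrable lborel (\<lambda>x. K * indicator (cbox a b) x)"
    by (intro integrable_mult_right integrable_real_indicator)
       (simp_all add: emeasure_lborel_cbox_finite[simplified])
  then show ?thesis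
  proof (rule Bochner_Integration.integrable_bound)
    show "AE x in lborel. norm (f x) \<le> norm (K * indicator (cbox a b) x)"
    proof (rule AE_I2)
      fix x
      show "norm (f x) \<le> norm (K * indicator (cbox a b) x)"
        using ab assms(3)[of x] by (cases "x \<in> cbox a b") auto
    qed
  qed (use assms(1) in simp)
qed

lemma L2_bounded_support:
  assumes \<Omega>: "open \<Omega>" and f: "f \<in> borel_measurable borel"
    and supp: "bounded {x\<in>\<Omega>. f x \<noteq> 0}" and bound: "\<And>x. x \<in> \<Omega> \<Longrightarrow> cmod (f x) \<le> K"
  shows "f \<in> L2 \<Omega>"
proof -
  have "\<Omega> \<in> sets borel" using \<Omega> by simp
  have "integrable lborel (\<lambda>x. indicator \<Omega> x *\<^sub>R (cmod (f x))\<^sup>2)"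
  proof (rule integrable_bounded_support)
    show "bounded {x. indicator \<Omega> x *\<^sub>R (cmod (f x))\<^sup>2 \<noteq> 0}"
      by (rule bounded_subset[OF supp]) (auto simp: indicator_def)
    show "norm (indicator \<Omega> x *\<^sub>R (cmod (f x))\<^sup>2) \<le> K\<^sup>2" for x
      using bound[of x] by (auto simp: indicator_def intro: power_mono)
  qed (use f \<open>\<Omega> \<in> sets borel\<close> in measurable)
  moreover have "f \<in> borel_measurable (lebesgue_on \<Omega>)"
    using f by (simp add: measurable_completion measurable_restrict_space1)
  ultimately show ?thesis
    using integral_lebesgue_on_eq_lborel(2)[OF \<Omega>, of "\<lambda>x. (cmod (f x))\<^sup>2"] f
    by (simp add: L2_def)
qed

lemma continuous_bounded_support_bounded:
  fixes f :: "'a::euclidean_space \<Rightarrow> 'b::real_normed_vector"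
  assumes "continuous_on UNIV f" "bounded S"
  obtains K where "K > 0" "\<And>x. x \<in> S \<Longrightarrow> norm (f x) \<le> K"
proof -
  have "compact (f ` closure S)"
    using assms by (intro compact_continuous_image) (auto intro: continuous_on_subset)
  then have "bounded (f ` closure S)" by (rule compact_imp_bounded)
  then obtain K where "K > 0" "\<forall>y\<in>f ` closure S. norm y \<le> K" by (auto simp: bounded_pos)
  then show ?thesis using closure_subset[of S] by (intro that[of K]) auto
qed

lemma L2_continuous_bounded_support:
  assumes "open \<Omega>" "continuous_on UNIV f" "bounded {x\<in>\<Omega>. f x \<noteq> 0}"
  shows "f \<in> L2 \<Omega>"
proof -
  obtain K where "K > 0" "\<And>x. x \<in> {x\<in>\<Omega>. f x \<noteq> 0} \<Longrightarrow> cmod (f x) \<le> K"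
    using continuous_bounded_support_bounded[OF assms(2,3)] by blast
  then have "cmod (f x) \<le> K" if "x \<in> \<Omega>" for x
    using that by (cases "f x = 0") auto
  then show ?thesis
    using assms by (intro L2_bounded_support[where K = K] borel_measurable_continuous_onI) auto
qed

lemma integrable_continuous_bounded_support:
  fixes f :: "'a::euclidean_space \<Rightarrow> 'b::{banach, second_countable_topology}"
  assumes "continuous_on UNIV f" "bounded {x. f x \<noteq> 0}"
  shows "integrable lborel f"
proof -
  obtain K where "K > 0" "\<And>x. x \<in> {x. f x \<noteq> 0} \<Longrightarrow> norm (f x) \<le> K"
    using continuous_bounded_support_bounded[OF assms] by blast
  then have "norm (f x) \<le> K" for x
    by (cases "f x = 0") auto
  then show ?thesis
    using assms by (intro integrable_bounded_support[where K = K] borel_measurable_continuous_onI) auto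
qed

section \<open>Smooth functions\<close>

definition smooth :: "('a::euclidean_space \<Rightarrow> complex) \<Rightarrow> bool" where
  "smooth f \<longleftrightarrow> (\<forall>k. C_k k f)"

lemma partial_eq: "(f has_derivative D) (at x) \<Longrightarrow> partial b f x = D b"
  using frechet_derivative_at by metis

lemma C_k_continuous: "C_k k f \<Longrightarrow> continuous_on UNIV f"
  by (cases k) (auto simp: differentiable_at_imp_differentiable_on intro!: differentiable_imp_continuous_on)

lemma C_k_Suc_imp: "C_k (Suc k) f \<Longrightarrow> C_k k f"
proof (induction k arbitrary: f)
  case 0
  then show ?case using C_k_continuous[OF 0] by simp
next
  case (Suc k)
  from Suc.prems have diff: "\<And>x. f differentiable (at x)"
    and part: "\<And>b. b \<in> Basis \<Longrightarrow> C_k (Suc k) (partial b f)"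
    by (subst (asm) C_k.simps(2), blast)+
  show ?case using diff Suc.IH[OF part] by simp
qed

lemma smooth_differentiable:
  assumes "smooth f"
  shows "f differentiable (at x)"
proof -
  have "C_k (Suc 0) f" using assms unfolding smooth_def by (rule spec)
  then show ?thesis by simp
qed

lemma smooth_has_derivative: "smooth f \<Longrightarrow> (f has_derivative frechet_derivative f (at x)) (at x)"
  by (rule frechet_derivative_works[THEN iffD1, OF smooth_differentiable])

lemma smooth_partial:
  assumes "smooth f" "b \<in> Basis"
  shows "smooth (partial b f)"
  unfolding smooth_def
proof
  fix k
  have "C_k (Suc k) f" using assms(1) unfolding smooth_def by (rule spec)
  then show "C_k k (partial b f)" using assms(2) by simp
qed

lemma smooth_continuous: "smooth f \<Longrightarrow> continuous_on UNIV f"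
  unfolding smooth_def using C_k_continuous by blast

text \<open>
  Smoothness is the greatest property that implies differentiability and passes to the partial
  derivatives, so it can be verified for a whole family of functions at once.
\<close>
lemma smooth_coinduct:
  assumes "f \<in> S" "\<And>g x. g \<in> S \<Longrightarrow> g differentiable (at x)"
    and "\<And>g b. g \<in> S \<Longrightarrow> b \<in> Basis \<Longrightarrow> partial b g \<in> S"
  shows "smooth f"
proof -
  have "C_k k g" if "g \<in> S" for k g
    using that
  proof (induction k arbitrary: g)
    case 0
    then have "continuous_on UNIV g"
      using assms(2) by (auto simp: differentiable_at_imp_differentiable_on intro!: differentiable_imp_continuous_on)
    then show ?case by simp
  qed (use assms(2,3) in auto)
  then show ?thesis using assms(1) by (simp add: smooth_def)
qed

lemma partial_const: "partial b (\<lambda>x. c) = (\<lambda>x. 0)"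
  by (simp add: frechet_derivative_const)

lemma smooth_const: "smooth (\<lambda>x. c)"
  by (rule smooth_coinduct[where S = "range (\<lambda>c x. c)"]) (auto simp: partial_const)

lemma partial_add:
  assumes "f differentiable (at x)" "g differentiable (at x)"
  shows "partial b (\<lambda>x. f x + g x) x = partial b f x + partial b g x"
  by (rule partial_eq) (use assms in \<open>auto intro!: has_derivative_add simp: frechet_derivative_works\<close>)

lemma partial_mult:
  assumes "f differentiable (at x)" "g differentiable (at x)"
  shows "partial b (\<lambda>x. f x * g x) x = f x * partial b g x + partial b f x * g x"
  by (rule partial_eq) (use assms in \<open>auto intro!: has_derivative_mult simp: frechet_derivative_works\<close>)

lemma C_k_add: "C_k k f \<Longrightarrow> C_k k g \<Longrightarrow> C_k k (\<lambda>x. f x + g x)"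
proof (induction k arbitrary: f g)
  case (Suc k)
  then have "partial b (\<lambda>x. f x + g x) = (\<lambda>x. partial b f x + partial b g x)" for b
    by (intro ext partial_add) auto
  then show ?case using Suc by auto
qed (auto intro: continuous_intros)

lemma C_k_mult: "C_k k f \<Longrightarrow> C_k k g \<Longrightarrow> C_k k (\<lambda>x. f x * g x)"
proof (induction k arbitrary: f g)
  case (Suc k)
  have "partial b (\<lambda>x. f x * g x) = (\<lambda>x. f x * partial b g x + partial b f x * g x)" for b
    using Suc.prems by (intro ext partial_mult) auto
  then show ?case
    using Suc.prems Suc.IH C_k_Suc_imp[OF Suc.prems(1)] C_k_Suc_imp[OF Suc.prems(2)]
    by (auto intro!: C_k_add)
qed (auto intro: continuous_intros)

lemma smooth_mult: "smooth f \<Longrightarrow> smooth g \<Longrightarrow> smooth (\<lambda>x. f x * g x)"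
  by (simp add: smooth_def C_k_mult)

lemma partial_cnj:
  assumes "f differentiable (at x)"
  shows "partial b (\<lambda>x. cnj (f x)) x = cnj (partial b f x)"
proof (rule partial_eq)
  show "((\<lambda>x. cnj (f x)) has_derivative (\<lambda>b. cnj (partial b f x))) (at x)"
    by (rule has_derivative_cnj[OF frechet_derivative_works[THEN iffD1, OF assms]])
qed

lemma smooth_cnj: "smooth f \<Longrightarrow> smooth (\<lambda>x. cnj (f x))"
proof (rule smooth_coinduct[where S = "{\<lambda>x. cnj (g x) |g. smooth g}"])
  fix h :: "'a \<Rightarrow> complex" and b :: 'a and x :: 'a
  assume "h \<in> {\<lambda>x. cnj (g x) |g. smooth g}"
  then obtain g where g: "smooth g" "h = (\<lambda>x. cnj (g x))" by blast
  show "h differentiable (at x)"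
    using has_derivative_cnj[OF smooth_has_derivative[OF g(1)]] g(2)
    unfolding differentiable_def by blast
  assume "b \<in> Basis"
  moreover have "partial b h = (\<lambda>x. cnj (partial b g x))"
    unfolding g(2) by (intro ext partial_cnj smooth_differentiable g(1))
  ultimately show "partial b h \<in> {\<lambda>x. cnj (g x) |g. smooth g}"
    using smooth_partial[OF g(1), of b] by auto
qed blast

lemma exp_linear_has_derivative:
  assumes "bounded_linear l"
  shows "((\<lambda>x. exp (l x)) has_derivative (\<lambda>b. l b * exp (l x :: complex))) (at x)"
proof -
  have "(l has_derivative l) (at x)" using assms by (rule bounded_linear_imp_has_derivative)
  from has_derivative_compose[OF this DERIV_exp[unfolded has_field_derivative_def]]
  show ?thesis by (simp only: mult.commute)
qed

section \<open>Flat functions\<close>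

text \<open>
  Multiplying \<open>exp (-1/y)\<close> by polynomials in \<open>1/y\<close> gives a family that contains the classical smooth
  function with all derivatives zero at the origin and is closed under differentiation.
\<close>

definition flat :: "real poly \<Rightarrow> real \<Rightarrow> real" where
  "flat p y = (if 0 < y then poly p (1 / y) * exp (- (1 / y)) else 0)"

definition flat_deriv :: "real poly \<Rightarrow> real poly" where
  "flat_deriv p = pCons 0 (pCons 0 (p - pderiv p))"

text \<open>The extra power makes the induction on the polynomial go through.\<close>
lemma power_poly_exp_tendsto_0:
  "((\<lambda>u::real. u ^ k * poly p u * exp (- u)) \<longlongrightarrow> 0) at_top"
proof (induction p arbitrary: k)
  case (pCons a p)
  have "((\<lambda>u. a * (u ^ k / exp u) + u ^ Suc k * poly p u * exp (- u)) \<longlongrightarrow> a * 0 + 0) at_top"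
    by (intro tendsto_add tendsto_mult tendsto_const tendsto_power_div_exp_0 pCons.IH)
  then show ?case
    by (simp add: algebra_simps exp_minus divide_inverse)
qed simp

lemma poly_exp_tendsto_0: "((\<lambda>u::real. poly p u * exp (- u)) \<longlongrightarrow> 0) at_top"
  using power_poly_exp_tendsto_0[of 0] by simp

text \<open>In the variable \<open>u = 1/h\<close> the difference quotient is a polynomial in \<open>u\<close> times \<open>exp (-u)\<close>.\<close>
lemma flat_has_derivative_at_0: "(flat p has_real_derivative 0) (at 0)"
proof -
  have "((\<lambda>h. flat p h / h) \<longlongrightarrow> 0) (at_right 0)"
  proof (rule Lim_transform_eventually)
    show "((\<lambda>h. poly (pCons 0 p) (inverse h) * exp (- inverse h)) \<longlongrightarrow> 0) (at_right (0::real))"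
      by (rule filterlim_compose[OF poly_exp_tendsto_0 filterlim_inverse_at_top_right])
    show "\<forall>\<^sub>F h in at_right 0. poly (pCons 0 p) (inverse h) * exp (- inverse h) = flat p h / h"
      unfolding eventually_at_filter
      by (rule always_eventually) (simp add: flat_def divide_inverse)
  qed
  moreover have "((\<lambda>h. flat p h / h) \<longlongrightarrow> 0) (at_left 0)"
    by (rule Lim_transform_eventually[OF tendsto_const])
       (simp add: eventually_at_filter flat_def)
  ultimately have "((\<lambda>h. flat p h / h) \<longlongrightarrow> 0) (at 0)"
    using filterlim_split_at by blast
  then show ?thesis by (simp add: DERIV_def flat_def[of p 0])
qed

lemma flat_has_derivative: "(flat p has_real_derivative flat (flat_deriv p) y) (at y)"
proof -
  consider "y < 0" | "y = 0" | "y > 0" by linarith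
  then show ?thesis
  proof cases
    case 1
    have "((\<lambda>_. 0) has_real_derivative 0) (at y)" by simp
    then have "(flat p has_real_derivative 0) (at y)"
      by (rule has_field_derivative_transform_within_open[of _ _ _ "{..<0}"])
         (use 1 in \<open>auto simp: flat_def\<close>)
    then show ?thesis using 1 by (simp add: flat_def)
  next
    case 2
    then show ?thesis using flat_has_derivative_at_0 by (simp add: flat_def)
  next
    case 3
    have "((\<lambda>y. poly p (1 / y) * exp (- (1 / y))) has_real_derivative flat (flat_deriv p) y) (at y)"
    proof -
      have "((\<lambda>y. 1 / y) has_real_derivative - (1 / y\<^sup>2)) (at y)"
        using 3 by (auto intro!: derivative_eq_intros simp: power2_eq_square)
      note D = DERIV_mult[OF DERIV_chain2[OF poly_DERIV this]
          DERIV_chain2[OF DERIV_exp DERIV_minus[OF this]], of p]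
      show ?thesis
        by (rule DERIV_cong[OF D])
           (use 3 in \<open>simp add: flat_def flat_deriv_def power2_eq_square algebra_simps\<close>)
    qed
    then show ?thesis
      by (rule has_field_derivative_transform_within_open[of _ _ _ "{0<..}"])
         (use 3 in \<open>auto simp: flat_def\<close>)
  qed
qed

lemma flat_bounded: obtains K where "K > 0" "\<And>y. \<bar>flat p y\<bar> \<le> K"
proof -
  have "\<forall>\<^sub>F u in at_top. norm (poly p u * exp (- u)) < 1"
    using order_tendstoD(2)[OF tendsto_norm_zero[OF poly_exp_tendsto_0]] by simp
  then obtain U where U: "\<And>u. u \<ge> U \<Longrightarrow> norm (poly p u * exp (- u)) < 1"
    by (auto simp: eventually_at_top_linorder)
  have "compact ((\<lambda>u. poly p u * exp (- u)) ` {0..U})"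
    by (intro compact_continuous_image continuous_intros) auto
  then obtain B where B: "\<And>u. u \<in> {0..U} \<Longrightarrow> norm (poly p u * exp (- u)) \<le> B"
    unfolding compact_eq_bounded_closed bounded_iff by blast
  have le: "\<bar>poly p u * exp (- u)\<bar> \<le> max 1 B" if "u \<ge> 0" for u
    using U[of u] B[of u] that by (cases "u \<ge> U") auto
  have "\<bar>flat p y\<bar> \<le> max 1 B" for y
    using le[of "1 / y"] by (auto simp: flat_def)
  then show ?thesis by (intro that[of "max 1 B"]) auto
qed

text \<open>Dilations of a flat function with constant term \<open>1\<close> thus approach the indicator of the half-line.\<close>
lemma flat_tendsto: "(flat p \<longlongrightarrow> poly p 0) at_top"
proof (rule Lim_transform_eventually)
  have inv: "((\<lambda>y::real. 1 / y) \<longlongrightarrow> 0) at_top"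
    using tendsto_inverse_0_at_top[OF filterlim_ident] by (simp add: inverse_eq_divide)
  show "((\<lambda>y. poly p (1 / y) * exp (- (1 / y))) \<longlongrightarrow> poly p 0) at_top"
    by (rule tendsto_eq_rhs[OF tendsto_mult[OF isCont_tendsto_compose[OF poly_isCont inv]
          tendsto_exp[OF tendsto_minus[OF inv]]]]) simp
  show "\<forall>\<^sub>F y in at_top. poly p (1 / y) * exp (- (1 / y)) = flat p y"
    using eventually_gt_at_top[of 0] by eventually_elim (simp add: flat_def)
qed

lemma flat_affine_has_derivative:
  assumes "bounded_linear l"
  shows "((\<lambda>x. complex_of_real (flat p (l x + c))) has_derivative
      (\<lambda>b. complex_of_real (l b * flat (flat_deriv p) (l x + c)))) (at x)"
proof -
  have "((\<lambda>x. l x + c) has_derivative l) (at x)"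
    using has_derivative_add_const[OF bounded_linear_imp_has_derivative[OF assms]] .
  from has_derivative_compose[OF this flat_has_derivative[unfolded has_field_derivative_def]]
  have "((\<lambda>x. flat p (l x + c)) has_derivative (\<lambda>b. l b * flat (flat_deriv p) (l x + c))) (at x)"
    by (simp only: mult.commute)
  from has_derivative_of_real[OF this] show ?thesis by simp
qed

lemma flat_smult: "flat (smult a p) y = a * flat p y"
  by (simp add: flat_def)

lemma partial_flat_affine:
  "bounded_linear l \<Longrightarrow> partial b (\<lambda>x. complex_of_real (flat p (l x + c))) x
    = complex_of_real (l b * flat (flat_deriv p) (l x + c))"
  by (rule partial_eq[OF flat_affine_has_derivative])

lemma smooth_flat_affine:
  assumes l: "bounded_linear l"
  shows "smooth (\<lambda>x. complex_of_real (flat p (l x + c)))"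
proof (rule smooth_coinduct[where S = "range (\<lambda>p x. complex_of_real (flat p (l x + c)))"])
  fix g :: "'a \<Rightarrow> complex" and b :: 'a and x :: 'a
  assume "g \<in> range (\<lambda>p x. complex_of_real (flat p (l x + c)))"
  then obtain q where g: "g = (\<lambda>x. complex_of_real (flat q (l x + c)))" by blast
  show "g differentiable (at x)"
    unfolding g differentiable_def using flat_affine_has_derivative[OF l] by blast
  have "partial b g = (\<lambda>x. complex_of_real (flat (smult (l b) (flat_deriv q)) (l x + c)))"
    by (simp add: g partial_flat_affine[OF l] flat_smult)
  then show "partial b g \<in> range (\<lambda>p x. complex_of_real (flat p (l x + c)))" by blast
qed blast

section \<open>Uniqueness of weak derivatives\<close>

lemma test_functionsD:
  assumes "\<phi> \<in> test_functions \<Omega>"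
  shows "smooth \<phi>" "bounded {x. \<phi> x \<noteq> 0}" "closure {x. \<phi> x \<noteq> 0} \<subseteq> \<Omega>"
    and "x \<notin> \<Omega> \<Longrightarrow> \<phi> x = 0"
proof -
  have c: "(\<forall>k. C_k k \<phi>) \<and> compact (closure {x. \<phi> x \<noteq> 0}) \<and> closure {x. \<phi> x \<noteq> 0} \<subseteq> \<Omega>"
    using assms unfolding test_functions_def by (rule CollectD)
  note \<phi> = conjunct1[OF c] conjunct1[OF conjunct2[OF c]] conjunct2[OF conjunct2[OF c]]
  show "smooth \<phi>" unfolding smooth_def by (rule \<phi>(1))
  show "closure {x. \<phi> x \<noteq> 0} \<subseteq> \<Omega>" by (rule \<phi>(3))
  show "bounded {x. \<phi> x \<noteq> 0}"
    by (rule bounded_subset[OF compact_imp_bounded[OF \<phi>(2)] closure_subset])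
  show "\<phi> x = 0" if "x \<notin> \<Omega>"
    using that subsetD[OF subset_trans[OF closure_subset \<phi>(3)], of x] by auto
qed

lemma test_functionsI:
  assumes "smooth \<phi>" "compact K" "K \<subseteq> \<Omega>" "\<And>x. \<phi> x \<noteq> 0 \<Longrightarrow> x \<in> K"
  shows "\<phi> \<in> test_functions \<Omega>"
proof -
  have "closure {x. \<phi> x \<noteq> 0} \<subseteq> K"
    using assms by (intro closure_minimal compact_imp_closed) auto
  moreover from this have "compact (closure {x. \<phi> x \<noteq> 0})"
    using compact_Int_closed[OF assms(2) closed_closure] by (metis inf.absorb2)
  ultimately show ?thesis
    using assms(1,3) unfolding test_functions_def smooth_def by auto
qed

lemma partial_eq_0:
  assumes "open S" "x \<in> S" "\<And>y. y \<in> S \<Longrightarrow> f y = 0"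
  shows "partial b f x = 0"
proof -
  have "(f has_derivative (\<lambda>_. 0)) (at x)"
    by (rule has_derivative_transform_within_open[OF has_derivative_const assms(1,2)])
       (use assms(3) in auto)
  then show ?thesis by (rule partial_eq)
qed

lemma partial_support: "{x. partial b f x \<noteq> 0} \<subseteq> closure {x. f x \<noteq> 0}"
proof
  fix x assume "x \<in> {x. partial b f x \<noteq> 0}"
  moreover have "partial b f x = 0" if "x \<notin> closure {x. f x \<noteq> 0}"
    by (rule partial_eq_0[where S = "- closure {x. f x \<noteq> 0}"])
       (use that closure_subset[of "{x. f x \<noteq> 0}"] in auto)
  ultimately show "x \<in> closure {x. f x \<noteq> 0}" by blast
qed

lemma test_function_partial:
  assumes "\<phi> \<in> test_functions \<Omega>" "b \<in> Basis"
  shows "partial b \<phi> \<in> test_functions \<Omega>"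
proof (rule test_functionsI[where K = "closure {x. \<phi> x \<noteq> 0}"])
  show "smooth (partial b \<phi>)" by (rule smooth_partial[OF test_functionsD(1)[OF assms(1)] assms(2)])
  show "compact (closure {x. \<phi> x \<noteq> 0})" using test_functionsD(2)[OF assms(1)] by simp
  show "closure {x. \<phi> x \<noteq> 0} \<subseteq> \<Omega>" by (rule test_functionsD(3)[OF assms(1)])
  show "x \<in> closure {x. \<phi> x \<noteq> 0}" if "partial b \<phi> x \<noteq> 0" for x
    using that partial_support[where f = \<phi> and b = b] by blast
qed

lemma test_functions_L2:
  assumes "open \<Omega>" "\<phi> \<in> test_functions \<Omega>"
  shows "\<phi> \<in> L2 \<Omega>"
proof (rule L2_continuous_bounded_support[OF assms(1)])
  show "continuous_on UNIV \<phi>" by (rule smooth_continuous[OF test_functionsD(1)[OF assms(2)]])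
  show "bounded {x\<in>\<Omega>. \<phi> x \<noteq> 0}" by (rule bounded_subset[OF test_functionsD(2)[OF assms(2)]]) blast
qed

lemma smooth_prod:
  "finite I \<Longrightarrow> (\<And>i. i \<in> I \<Longrightarrow> smooth (f i)) \<Longrightarrow> smooth (\<lambda>x. \<Prod>i\<in>I. f i x)"
  by (induction I rule: finite_induct) (auto intro: smooth_const smooth_mult)

text \<open>The \<open>j\<close>-th cutoff vanishes up to distance \<open>1/j\<close> from both ends of the interval \<open>(a, b)\<close>.\<close>
definition cutoff :: "real \<Rightarrow> real \<Rightarrow> nat \<Rightarrow> real \<Rightarrow> real" where
  "cutoff a b j t = flat 1 (j * (t - a) - 1) * flat 1 (j * (b - t) - 1)"

lemma flat_1_bounds: "0 \<le> flat 1 y" "flat 1 y \<le> 1"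
  by (auto simp: flat_def)

lemma cutoff_bounds: "0 \<le> cutoff a b j t" "cutoff a b j t \<le> 1"
  using mult_le_one[OF flat_1_bounds(2) flat_1_bounds(1,2)] by (auto simp: cutoff_def flat_1_bounds)

lemma cutoff_nonzero:
  assumes "cutoff a b j t \<noteq> 0"
  shows "0 < j" "a + 1 / j < t" "t < b - 1 / j"
proof -
  have pos: "j * (t - a) > 1" "j * (b - t) > 1"
    using assms by (auto simp: cutoff_def flat_def split: if_splits)
  then show "0 < j" by (cases j) auto
  then show "a + 1 / j < t" "t < b - 1 / j"
    using pos by (auto simp: field_simps)
qed

lemma flat_dilation_tendsto:
  assumes "0 < r"
  shows "(\<lambda>j. flat p (real j * r - 1)) \<longlonglongrightarrow> poly p 0"
proof (rule filterlim_compose[OF flat_tendsto])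
  have "filterlim (\<lambda>j. -1 + real j * r) at_top sequentially"
    by (intro filterlim_tendsto_add_at_top[OF tendsto_const]
        filterlim_at_top_mult_tendsto_pos[OF tendsto_const assms] filterlim_real_sequentially)
  then show "filterlim (\<lambda>j. real j * r - 1) at_top sequentially" by simp
qed

lemma cutoff_tendsto: "(\<lambda>j. cutoff a b j t) \<longlonglongrightarrow> (if a < t \<and> t < b then 1 else 0)"
proof (cases "a < t \<and> t < b")
  case True
  then have "(\<lambda>j. cutoff a b j t) \<longlonglongrightarrow> poly 1 0 * poly 1 0"
    unfolding cutoff_def by (intro tendsto_mult flat_dilation_tendsto) auto
  then show ?thesis using True by simp
next
  case False
  have "cutoff a b j t = 0" for j
  proof (rule ccontr)
    assume "cutoff a b j t \<noteq> 0"
    note nz = cutoff_nonzero[OF this]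
    have "0 < 1 / real j" using nz(1) by simp
    with nz(2,3) False show False by linarith
  qed
  then show ?thesis unfolding if_not_P[OF False] by simp
qed

lemma smooth_cutoff:
  assumes "bounded_linear l"
  shows "smooth (\<lambda>x. complex_of_real (cutoff a b j (l x)))"
proof -
  have 1: "smooth (\<lambda>x. complex_of_real (flat 1 (real j * l x + (- (j * a) - 1))))"
    by (rule smooth_flat_affine[OF bounded_linear_const_mult[OF assms]])
  have 2: "smooth (\<lambda>x. complex_of_real (flat 1 (- real j * l x + (j * b - 1))))"
    by (rule smooth_flat_affine[OF bounded_linear_const_mult[OF assms]])
  show ?thesis
    using smooth_mult[OF 1 2] by (simp add: cutoff_def algebra_simps)
qed

text \<open>
  Products of cutoffs are test functions that converge boundedly to the indicator of the open box.
\<close>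
lemma integral_box_eq_0:
  fixes h :: "'a::euclidean_space \<Rightarrow> complex"
  assumes \<Omega>: "open \<Omega>" and h: "h \<in> L2 \<Omega>"
    and orth: "\<And>\<phi>. \<phi> \<in> test_functions \<Omega> \<Longrightarrow> (\<integral>x. h x * \<phi> x \<partial>lebesgue_on \<Omega>) = 0"
    and box: "cbox a b \<subseteq> \<Omega>"
  shows "(\<integral>x. h x * indicator (box a b) x \<partial>lebesgue_on \<Omega>) = 0"
proof -
  define \<phi> where "\<phi> j x = (\<Prod>i\<in>Basis. complex_of_real (cutoff (a \<bullet> i) (b \<bullet> i) j (x \<bullet> i)))"
    for j and x :: 'a
  have nz: "x \<in> cbox a b" if "\<phi> j x \<noteq> 0" for j x
  proof (unfold mem_box, rule ballI)
    fix i :: 'a assume "i \<in> Basis"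
    with that have "cutoff (a \<bullet> i) (b \<bullet> i) j (x \<bullet> i) \<noteq> 0"
      by (auto simp: \<phi>_def)
    note nz = cutoff_nonzero[OF this]
    have "0 < 1 / real j" using nz(1) by simp
    with nz(2,3) show "a \<bullet> i \<le> x \<bullet> i \<and> x \<bullet> i \<le> b \<bullet> i" by linarith
  qed
  have test: "\<phi> j \<in> test_functions \<Omega>" for j
  proof (rule test_functionsI[OF _ compact_cbox box])
    show "smooth (\<phi> j)"
      unfolding \<phi>_def by (intro smooth_prod smooth_cutoff bounded_linear_inner_left) auto
  qed (rule nz)
  have le: "cmod (\<phi> j x) \<le> indicator (cbox a b) x" for j x
  proof (cases "\<phi> j x = 0")
    case False
    have "cmod (\<phi> j x) \<le> (\<Prod>i\<in>(Basis::'a set). 1)"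
      unfolding \<phi>_def prod_norm[symmetric] by (intro prod_mono) (auto simp: cutoff_bounds)
    then show ?thesis using nz[OF False] by simp
  qed simp
  have lim: "(\<lambda>j. \<phi> j x) \<longlonglongrightarrow> indicator (box a b) x" for x
  proof -
    have "(\<lambda>j. \<phi> j x) \<longlonglongrightarrow>
        (\<Prod>i\<in>Basis. complex_of_real (if a \<bullet> i < x \<bullet> i \<and> x \<bullet> i < b \<bullet> i then 1 else 0))"
      unfolding \<phi>_def by (intro tendsto_prod tendsto_of_real cutoff_tendsto)
    also have "(\<Prod>i\<in>Basis. complex_of_real (if a \<bullet> i < x \<bullet> i \<and> x \<bullet> i < b \<bullet> i then 1 else 0))
        = indicator (box a b) x"
    proof (cases "x \<in> box a b")
      case False
      then obtain i where "i \<in> Basis" "\<not> (a \<bullet> i < x \<bullet> i \<and> x \<bullet> i < b \<bullet> i)"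
        by (auto simp: mem_box)
      then have "(\<Prod>i\<in>Basis. complex_of_real (if a \<bullet> i < x \<bullet> i \<and> x \<bullet> i < b \<bullet> i then 1 else 0)) = 0"
        by (intro prod_zero) (auto intro!: bexI[of _ i])
      then show ?thesis using False by simp
    qed (auto simp: mem_box intro!: prod.neutral)
    finally show ?thesis .
  qed
  have ind: "(\<lambda>x. complex_of_real (indicator (cbox a b) x)) \<in> L2 \<Omega>"
    by (rule L2_bounded_support[OF \<Omega>, where K = 1])
       (auto intro: bounded_subset[OF bounded_cbox[of a b]] simp: indicator_def split: if_splits)
  have "(\<lambda>j. \<integral>x. h x * \<phi> j x \<partial>lebesgue_on \<Omega>)
      \<longlonglongrightarrow> (\<integral>x. h x * indicator (box a b) x \<partial>lebesgue_on \<Omega>)"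
  proof (rule integral_dominated_convergence
      [where w = "\<lambda>x. norm (h x * complex_of_real (indicator (cbox a b) x))"])
    show "integrable (lebesgue_on \<Omega>) (\<lambda>x. norm (h x * complex_of_real (indicator (cbox a b) x)))"
      by (intro integrable_norm L2_mult_integrable h ind)
    show "AE x in lebesgue_on \<Omega>. (\<lambda>j. h x * \<phi> j x) \<longlonglongrightarrow> h x * indicator (box a b) x"
      by (intro AE_I2 tendsto_mult tendsto_const lim)
    show "AE x in lebesgue_on \<Omega>. norm (h x * \<phi> j x)
        \<le> norm (h x * complex_of_real (indicator (cbox a b) x))" for j
      by (rule AE_I2) (use le[of j] in \<open>simp add: norm_mult mult_left_mono\<close>)
    show "(\<lambda>x. h x * \<phi> j x) \<in> borel_measurable (lebesgue_on \<Omega>)" for j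
      by (intro borel_measurable_times L2_measurable h test_functions_L2[OF \<Omega> test])
    have "(indicator (box a b) :: 'a \<Rightarrow> complex) \<in> borel_measurable (lebesgue_on \<Omega>)"
      by (intro measurable_restrict_space1 measurable_completion borel_measurable_indicator) auto
    then show "(\<lambda>x. h x * indicator (box a b) x) \<in> borel_measurable (lebesgue_on \<Omega>)"
      by (rule borel_measurable_times[OF L2_measurable[OF h]])
  qed
  then show ?thesis by (simp add: orth[OF test] LIMSEQ_const_iff)
qed

text \<open>
  Open boxes generate the Borel sets and are closed under intersection, so the integral of \<open>f\<close>
  vanishes over every Borel set, and a Lebesgue set is a Borel set up to a null set.
\<close>
lemma AE_eq_0_if_box_integrals_eq_0:
  fixes f :: "'a::euclidean_space \<Rightarrow> 'b::{banach, second_countable_topology}"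
  assumes f: "integrable lebesgue f"
    and box: "\<And>a b. set_lebesgue_integral lebesgue (box a b) f = 0"
  shows "AE x in lebesgue. f x = 0"
proof -
  let ?G = "range (\<lambda>(a, b). box a b :: 'a set)"
  have set_int: "set_integrable lebesgue A f" if "A \<in> sets lebesgue" for A
    unfolding set_integrable_def by (rule integrable_mult_indicator[OF that f])
  have whole: "set_lebesgue_integral lebesgue UNIV f = 0"
  proof -
    let ?B = "\<lambda>i::nat. box (- (real i *\<^sub>R One)) (real i *\<^sub>R One) :: 'a set"
    have "(\<lambda>i. set_lebesgue_integral lebesgue (?B i) f)
        \<longlonglongrightarrow> set_lebesgue_integral lebesgue (\<Union>i. ?B i) f"
    proof (rule set_integral_cont_up)
      show "incseq ?B"
      proof (intro incseq_SucI subsetI)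
        fix n x assume x: "x \<in> ?B n"
        show "x \<in> ?B (Suc n)"
          unfolding mem_box
        proof (rule ballI)
          fix i :: 'a assume i: "i \<in> Basis"
          with x have "- real n < x \<bullet> i" "x \<bullet> i < real n" by (simp_all add: mem_box)
          then show "- (real (Suc n) *\<^sub>R One) \<bullet> i < x \<bullet> i \<and> x \<bullet> i < (real (Suc n) *\<^sub>R One) \<bullet> i"
            using i by simp
        qed
      qed
    qed (auto intro!: set_int)
    then show ?thesis
      unfolding UN_box_eq_UNIV box by (simp add: LIMSEQ_const_iff)
  qed
  have borel: "set_lebesgue_integral lebesgue A f = 0" if "A \<in> sets borel" for A
  proof -
    have sets: "sets (borel :: 'a measure) = sigma_sets UNIV ?G"
      unfolding borel_eq_box by (rule sets_measure_of) auto
    have stable: "Int_stable ?G" by (auto simp: Int_stable_def box_Int_box)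
    show ?thesis
    proof (rule sigma_sets_induct_disjoint[OF stable _ that[unfolded sets]])
      show "?G \<subseteq> Pow UNIV" by simp
    next
      fix A assume "A \<in> ?G"
      then show "set_lebesgue_integral lebesgue A f = 0" using box by auto
    next
      show "set_lebesgue_integral lebesgue {} f = 0" by (simp add: set_lebesgue_integral_def)
    next
      fix A assume A: "A \<in> sigma_sets UNIV ?G" and "set_lebesgue_integral lebesgue A f = 0"
      have A': "A \<in> sets lebesgue" using A unfolding sets[symmetric] by simp
      have "set_lebesgue_integral lebesgue (A \<union> (UNIV - A)) f =
          set_lebesgue_integral lebesgue A f + set_lebesgue_integral lebesgue (UNIV - A) f"
      proof (rule set_integral_Un)
        show "set_integrable lebesgue (UNIV - A) f"
          using sets.compl_sets[OF A'] by (intro set_int) simp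
      qed (auto intro: set_int A')
      then show "set_lebesgue_integral lebesgue (UNIV - A) f = 0"
        using whole \<open>set_lebesgue_integral lebesgue A f = 0\<close> by simp
    next
      fix A :: "nat \<Rightarrow> 'a set"
      assume dis: "disjoint_family A" and A: "range A \<subseteq> sigma_sets UNIV ?G"
        and 0: "\<And>i. set_lebesgue_integral lebesgue (A i) f = 0"
      have A': "A i \<in> sets lebesgue" for i
        using A unfolding sets[symmetric] by (auto intro: sets_completionI_sets)
      have "set_lebesgue_integral lebesgue (\<Union>i. A i) f
          = (\<Sum>i. set_lebesgue_integral lebesgue (A i) f)"
        by (rule lebesgue_integral_countable_add)
           (use dis A' in \<open>auto simp: disjoint_family_on_def intro!: set_int\<close>)
      then show "set_lebesgue_integral lebesgue (\<Union>i. A i) f = 0" by (simp add: 0)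
    qed
  qed
  interpret sigma_finite_measure "lebesgue :: 'a measure"
  proof
    obtain A :: "'a set set" where "countable A" "A \<subseteq> sets lborel" "\<Union>A = space lborel"
        "\<forall>a\<in>A. emeasure lborel a \<noteq> \<infinity>"
      using sigma_finite_measure.sigma_finite_countable[OF sigma_finite_lborel] by metis
    then show "\<exists>A. countable A \<and> A \<subseteq> sets lebesgue \<and> \<Union>A = space (lebesgue :: 'a measure)
        \<and> (\<forall>a\<in>A. emeasure lebesgue a \<noteq> \<infinity>)"
      by (intro exI[of _ A]) (auto simp: subset_eq)
  qed
  show ?thesis
  proof (rule density_zero[OF f])
    fix A :: "'a set" assume "A \<in> sets lebesgue"
    then obtain S N N' where A: "A = S \<union> N" "S \<in> sets lborel" "N \<subseteq> N'" "N' \<in> null_sets lborel"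
      unfolding sets_completion by (rule completionE)
    have "N' \<in> null_sets lebesgue" using A(4) by (rule null_sets_completionI)
    then have "AE x in lebesgue. x \<notin> N'" by (rule AE_not_in)
    then have ae: "AE x in lebesgue. indicator A x *\<^sub>R f x = indicator S x *\<^sub>R f x"
      by eventually_elim (use A(1,3) in \<open>auto simp: indicator_def\<close>)
    have "set_lebesgue_integral lebesgue A f = set_lebesgue_integral lebesgue S f"
      unfolding set_lebesgue_integral_def
    proof (rule integral_cong_AE[OF _ _ ae])
      show "(\<lambda>x. indicator A x *\<^sub>R f x) \<in> borel_measurable lebesgue"
        using integrable_mult_indicator[OF \<open>A \<in> sets lebesgue\<close> f] by (rule borel_measurable_integrable)
      show "(\<lambda>x. indicator S x *\<^sub>R f x) \<in> borel_measurable lebesgue"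
        by (rule borel_measurable_integrable[OF integrable_mult_indicator[OF _ f]]) (use A(2) in simp)
    qed
    then show "set_lebesgue_integral lebesgue A f = 0" using borel A(2) by simp
  qed
qed

text \<open>
  The fundamental lemma of the calculus of variations. Inside a box whose closure lies in \<open>\<Omega>\<close> all
  integrals over boxes vanish, and countably many such boxes cover \<open>\<Omega>\<close>.
\<close>
lemma orthogonal_to_test_functions_imp_AE_0:
  fixes h :: "'a::euclidean_space \<Rightarrow> complex"
  assumes \<Omega>: "open \<Omega>" and h: "h \<in> L2 \<Omega>"
    and orth: "\<And>\<phi>. \<phi> \<in> test_functions \<Omega> \<Longrightarrow> (\<integral>x. h x * \<phi> x \<partial>lebesgue_on \<Omega>) = 0"
  shows "AE x in lebesgue_on \<Omega>. h x = 0"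
proof -
  have \<Omega>L: "\<Omega> \<inter> space lebesgue \<in> sets lebesgue"
    using \<Omega> by (auto intro: sets_completionI_sets)
  have local: "AE x in lebesgue. x \<in> box c d \<longrightarrow> h x = 0" if cd: "cbox c d \<subseteq> \<Omega>" for c d
  proof -
    have ind: "(\<lambda>x. complex_of_real (indicator (box c d) x)) \<in> L2 \<Omega>"
      by (rule L2_bounded_support[OF \<Omega>, where K = 1])
         (auto intro: bounded_subset[OF bounded_box[of c d]] simp: indicator_def split: if_splits)
    have sub: "box c d \<subseteq> \<Omega>" using cd box_subset_cbox by blast
    have "integrable lebesgue (\<lambda>x. indicator \<Omega> x *\<^sub>R (h x * complex_of_real (indicator (box c d) x)))"
      using L2_mult_integrable[OF h ind] by (simp add: integrable_restrict_space[OF \<Omega>L])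
    also have "(\<lambda>x. indicator \<Omega> x *\<^sub>R (h x * complex_of_real (indicator (box c d) x)))
        = (\<lambda>x. indicator (box c d) x *\<^sub>R h x)"
      using sub by (auto simp: indicator_def fun_eq_iff)
    finally have int: "integrable lebesgue (\<lambda>x. indicator (box c d) x *\<^sub>R h x)" .
    have "AE x in lebesgue. indicator (box c d) x *\<^sub>R h x = 0"
    proof (rule AE_eq_0_if_box_integrals_eq_0[OF int])
      fix a b :: 'a
      obtain a' b' where ab: "box a b \<inter> box c d = box a' b'" and sub': "cbox a' b' \<subseteq> \<Omega>"
      proof (cases "box a b \<inter> box c d = {}")
        case True
        moreover have "box One (0::'a) = {}" "cbox One (0::'a) = {}"
          using SOME_Basis by (auto simp: box_eq_empty)
        ultimately show ?thesis using that[of One 0] by simp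
      next
        case False
        then obtain a' b' where eq: "box a b \<inter> box c d = box a' b'"
          using box_Int_box[of a b c d] by blast
        have ne: "box a' b' \<noteq> {}" "box c d \<noteq> {}" using False eq by auto
        have "box a' b' \<subseteq> box c d" using eq by auto
        then have "cbox a' b' \<subseteq> cbox c d"
          using closure_mono[of "box a' b'" "box c d"] unfolding closure_box[OF ne(1)] closure_box[OF ne(2)] by blast
        then show ?thesis using eq cd by (intro that[of a' b']) auto
      qed
      have "set_lebesgue_integral lebesgue (box a b) (\<lambda>x. indicator (box c d) x *\<^sub>R h x)
          = (\<integral>x. indicator \<Omega> x *\<^sub>R (h x * indicator (box a' b') x) \<partial>lebesgue)"
        unfolding set_lebesgue_integral_def ab[symmetric] using sub
        by (intro Bochner_Integration.integral_cong) (auto simp: indicator_def)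
      also have "\<dots> = (\<integral>x. h x * indicator (box a' b') x \<partial>lebesgue_on \<Omega>)"
        by (simp add: integral_restrict_space[OF \<Omega>L])
      also have "\<dots> = 0" by (rule integral_box_eq_0[OF \<Omega> h orth sub'])
      finally show "set_lebesgue_integral lebesgue (box a b) (\<lambda>x. indicator (box c d) x *\<^sub>R h x) = 0" .
    qed
    then show ?thesis by eventually_elim (auto simp: indicator_def)
  qed
  obtain D :: "'a set set" where D: "countable D" "D \<subseteq> Pow \<Omega>"
      "\<And>X. X \<in> D \<Longrightarrow> \<exists>a b. X = cbox a b" "\<Union>D = \<Omega>"
    using open_countable_Union_open_cbox[OF \<Omega>] by metis
  have "AE x in lebesgue. \<forall>X\<in>D. x \<in> X \<longrightarrow> h x = 0"
  proof (rule AE_ball_countable'[OF _ D(1)])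
    fix X assume "X \<in> D"
    with D(2,3) obtain c d where X: "X = cbox c d" "cbox c d \<subseteq> \<Omega>" by blast
    have "cbox c d - box c d \<in> null_sets lebesgue"
      using negligible_frontier_interval[of c d] by (simp add: negligible_iff_null_sets)
    then have "AE x in lebesgue. x \<notin> cbox c d - box c d" by (rule AE_not_in)
    with local[OF X(2)] show "AE x in lebesgue. x \<in> X \<longrightarrow> h x = 0"
      unfolding X(1) by eventually_elim blast
  qed
  then have "AE x in lebesgue. x \<in> \<Omega> \<longrightarrow> h x = 0"
    by eventually_elim (use D(4) in blast)
  then show ?thesis by (simp add: AE_restrict_space_iff[OF \<Omega>L])
qed

section \<open>Integration by parts in the plane\<close>

lemma Basis_plane: "(Basis :: (real \<times> real) set) = {(1, 0), (0, 1)}"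
  by (auto simp: Basis_prod_def)

lemma smooth_slice:
  assumes "smooth (f :: real \<times> real \<Rightarrow> complex)"
  shows "((\<lambda>z. f (x, z)) has_vector_derivative partial (0, 1) f (x, z)) (at z within S)"
    and "((\<lambda>x. f (x, z)) has_vector_derivative partial (1, 0) f (x, z)) (at x within S)"
proof -
  let ?D = "frechet_derivative f (at (x, z))"
  have D: "(f has_derivative ?D) (at (x, z))" by (rule smooth_has_derivative[OF assms])
  have lin: "linear ?D" using D has_derivative_linear by blast
  have "((\<lambda>z. (x, z)) has_derivative (\<lambda>h. (0, h))) (at z within S)"
    by (intro has_derivative_Pair has_derivative_const has_derivative_ident)
  from has_derivative_compose[OF this D]
  have "((\<lambda>z. f (x, z)) has_derivative (\<lambda>h. ?D (h *\<^sub>R (0, 1)))) (at z within S)" by simp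
  then show "((\<lambda>z. f (x, z)) has_vector_derivative ?D (0, 1)) (at z within S)"
    unfolding has_vector_derivative_def linear_cmul[OF lin] .
  have "((\<lambda>x. (x, z)) has_derivative (\<lambda>h. (h, 0))) (at x within S)"
    by (intro has_derivative_Pair has_derivative_const has_derivative_ident)
  from has_derivative_compose[OF this D]
  have "((\<lambda>x. f (x, z)) has_derivative (\<lambda>h. ?D (h *\<^sub>R (1, 0)))) (at x within S)" by simp
  then show "((\<lambda>x. f (x, z)) has_vector_derivative ?D (1, 0)) (at x within S)"
    unfolding has_vector_derivative_def linear_cmul[OF lin] .
qed

lemma integral_plane_iterated:
  fixes f :: "real \<times> real \<Rightarrow> 'b::{banach, second_countable_topology}"
  assumes "integrable lborel f"
  shows "(\<integral>p. f p \<partial>lborel) = (\<integral>x. (\<integral>z. f (x, z) \<partial>lborel) \<partial>lborel)"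
    and "(\<integral>p. f p \<partial>lborel) = (\<integral>z. (\<integral>x. f (x, z) \<partial>lborel) \<partial>lborel)"
proof -
  have int: "integrable (lborel \<Otimes>\<^sub>M lborel) f" using assms by (simp add: lborel_prod)
  show "(\<integral>p. f p \<partial>lborel) = (\<integral>x. (\<integral>z. f (x, z) \<partial>lborel) \<partial>lborel)"
    using lborel_pair.integral_fst'[OF int] by (simp add: lborel_prod)
  have int': "integrable (lborel \<Otimes>\<^sub>M lborel) (\<lambda>(x, z). f (x, z))" using int by simp
  show "(\<integral>p. f p \<partial>lborel) = (\<integral>z. (\<integral>x. f (x, z) \<partial>lborel) \<partial>lborel)"
    using lborel_pair.integral_snd[OF int'] by (simp add: lborel_prod)
qed

lemma integral_derivative_bounded_support:
  fixes g g' :: "real \<Rightarrow> 'b::euclidean_space"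
  assumes "\<And>t. (g has_vector_derivative g' t) (at t)" "continuous_on UNIV g'"
    and R: "\<And>t. \<bar>t\<bar> > R \<Longrightarrow> g t = 0 \<and> g' t = 0"
  shows "(\<integral>t. g' t \<partial>lborel) = 0"
proof -
  define a where "a = \<bar>R\<bar> + 1"
  have g': "g' = (\<lambda>t. indicator {-a..a} t *\<^sub>R g' t)"
    using R by (force simp: indicator_def a_def fun_eq_iff)
  have "(\<integral>t. indicator {-a..a} t *\<^sub>R g' t \<partial>lborel) = g a - g (- a)"
    by (rule integral_FTC_Icc)
       (auto simp: a_def intro: has_vector_derivative_at_within assms(1) continuous_on_subset[OF assms(2)])
  also have "\<dots> = 0" using R[of a] R[of "- a"] by (simp add: a_def)
  finally show ?thesis using g' by simp
qed

lemma smooth_partial_integrable: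
  assumes "smooth (f :: 'a::euclidean_space \<Rightarrow> complex)" "bounded {p. f p \<noteq> 0}" "b \<in> Basis"
  shows "integrable lborel (partial b f)"
proof (rule integrable_continuous_bounded_support)
  show "continuous_on UNIV (partial b f)" by (rule smooth_continuous[OF smooth_partial[OF assms(1,3)]])
  show "bounded {x. partial b f x \<noteq> 0}"
    by (rule bounded_subset[OF bounded_closure[OF assms(2)] partial_support])
qed

lemma integral_partial_eq_0:
  fixes f :: "real \<times> real \<Rightarrow> complex"
  assumes f: "smooth f" and supp: "bounded {p. f p \<noteq> 0}" and b: "b \<in> Basis"
  shows "(\<integral>p. partial b f p \<partial>lborel) = 0"
proof -
  have int: "integrable lborel (partial b f)" by (rule smooth_partial_integrable[OF f supp b])
  have cont: "continuous_on UNIV (partial b f)"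
    by (rule smooth_continuous[OF smooth_partial[OF f b]])
  obtain R where R: "\<And>p. p \<in> closure {p. f p \<noteq> 0} \<Longrightarrow> norm p \<le> R"
    using bounded_closure[OF supp] unfolding bounded_iff by blast
  have out: "f p = 0" "partial b f p = 0" if "norm p > R" for p
  proof -
    have "p \<notin> closure {p. f p \<noteq> 0}" using R[of p] that by auto
    then show "f p = 0" "partial b f p = 0"
      using closure_subset[of "{p. f p \<noteq> 0}"] partial_support[where f = f and b = b] by auto
  qed
  consider "b = (1, 0)" | "b = (0, 1)" using b by (auto simp: Basis_plane)
  then show ?thesis
  proof cases
    case 1
    have "(\<integral>x. partial b f (x, z) \<partial>lborel) = 0" for z
    proof (rule integral_derivative_bounded_support[where g = "\<lambda>x. f (x, z)" and R = R])
      show "((\<lambda>x. f (x, z)) has_vector_derivative partial b f (x, z)) (at x)" for x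
        unfolding 1 by (rule smooth_slice(2)[OF f])
      show "continuous_on UNIV (\<lambda>x. partial b f (x, z))"
        by (rule continuous_on_compose2[OF cont]) (auto intro: continuous_intros)
      show "f (x, z) = 0 \<and> partial b f (x, z) = 0" if "\<bar>x\<bar> > R" for x
        using out[of "(x, z)"] norm_fst_le[of x z] that by simp
    qed
    then show ?thesis unfolding integral_plane_iterated(2)[OF int] by simp
  next
    case 2
    have "(\<integral>z. partial b f (x, z) \<partial>lborel) = 0" for x
    proof (rule integral_derivative_bounded_support[where g = "\<lambda>z. f (x, z)" and R = R])
      show "((\<lambda>z. f (x, z)) has_vector_derivative partial b f (x, z)) (at z)" for z
        unfolding 2 by (rule smooth_slice(1)[OF f])
      show "continuous_on UNIV (\<lambda>z. partial b f (x, z))"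
        by (rule continuous_on_compose2[OF cont]) (auto intro: continuous_intros)
      show "f (x, z) = 0 \<and> partial b f (x, z) = 0" if "\<bar>z\<bar> > R" for z
        using out[of "(x, z)"] norm_snd_le[of z x] that by simp
    qed
    then show ?thesis unfolding integral_plane_iterated(1)[OF int] by simp
  qed
qed

lemma integral_by_parts_lborel:
  fixes f g :: "real \<times> real \<Rightarrow> complex"
  assumes f: "smooth f" and g: "smooth g" and supp: "bounded {p. g p \<noteq> 0}" and b: "b \<in> Basis"
  shows "(\<integral>p. f p * partial b g p \<partial>lborel) = - (\<integral>p. partial b f p * g p \<partial>lborel)"
proof -
  note cf = smooth_continuous[OF f] and cf' = smooth_continuous[OF smooth_partial[OF f b]]
    and cg = smooth_continuous[OF g] and cg' = smooth_continuous[OF smooth_partial[OF g b]]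
  have "bounded {p. partial b g p \<noteq> 0}"
    by (rule bounded_subset[OF bounded_closure[OF supp] partial_support])
  then have int1: "integrable lborel (\<lambda>p. f p * partial b g p)"
    by (intro integrable_continuous_bounded_support continuous_on_mult cf cg')
       (erule bounded_subset, auto)
  have int2: "integrable lborel (\<lambda>p. partial b f p * g p)"
    using supp by (intro integrable_continuous_bounded_support continuous_on_mult cf' cg)
       (erule bounded_subset, auto)
  have "bounded {p. f p * g p \<noteq> 0}" using supp by (rule bounded_subset) auto
  from integral_partial_eq_0[OF smooth_mult[OF f g] this b]
  have "(\<integral>p. f p * partial b g p + partial b f p * g p \<partial>lborel) = 0"
    by (simp add: partial_mult[OF smooth_differentiable[OF f] smooth_differentiable[OF g]])
  then show ?thesis
    using Bochner_Integration.integral_add[OF int1 int2] by (simp add: eq_neg_iff_add_eq_0)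
qed

lemma integral_lebesgue_on_support:
  fixes f :: "'a::euclidean_space \<Rightarrow> 'b::{banach, second_countable_topology}"
  assumes "open \<Omega>" "continuous_on UNIV f" "\<And>x. x \<notin> \<Omega> \<Longrightarrow> f x = 0"
  shows "integral\<^sup>L (lebesgue_on \<Omega>) f = (\<integral>x. f x \<partial>lborel)"
proof -
  have "(\<lambda>x. indicator \<Omega> x *\<^sub>R f x) = f" using assms(3) by (auto simp: indicator_def fun_eq_iff)
  then show ?thesis
    using integral_lebesgue_on_eq_lborel(1)[OF assms(1) borel_measurable_continuous_onI[OF assms(2)]]
    by simp
qed

section \<open>Weak derivatives of smooth functions\<close>

lemma smooth_has_weak_partial:
  fixes f :: "real \<times> real \<Rightarrow> complex"
  assumes \<Omega>: "open \<Omega>" and f: "smooth f" and b: "b \<in> Basis"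
  shows "has_weak_partial \<Omega> b f (partial b f)"
  unfolding has_weak_partial_def
proof
  fix \<phi> assume \<phi>: "\<phi> \<in> test_functions \<Omega>"
  note \<phi>' = test_function_partial[OF \<phi> b]
  note c = smooth_continuous[OF f] smooth_continuous[OF smooth_partial[OF f b]]
    smooth_continuous[OF test_functionsD(1)[OF \<phi>]] smooth_continuous[OF test_functionsD(1)[OF \<phi>']]
  have "(\<integral>p. f p * partial b \<phi> p \<partial>lebesgue_on \<Omega>) = (\<integral>p. f p * partial b \<phi> p \<partial>lborel)"
    by (intro integral_lebesgue_on_support \<Omega> continuous_on_mult c)
       (simp add: test_functionsD(4)[OF \<phi>'])
  also have "\<dots> = - (\<integral>p. partial b f p * \<phi> p \<partial>lborel)"
    by (rule integral_by_parts_lborel[OF f test_functionsD(1,2)[OF \<phi>] b])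
  also have "(\<integral>p. partial b f p * \<phi> p \<partial>lborel) = (\<integral>p. partial b f p * \<phi> p \<partial>lebesgue_on \<Omega>)"
    by (rule integral_lebesgue_on_support[symmetric])
       (auto intro: \<Omega> continuous_on_mult c simp: test_functionsD(4)[OF \<phi>])
  finally show "(\<integral>p. f p * partial b \<phi> p \<partial>lebesgue_on \<Omega>)
      = - (\<integral>p. partial b f p * \<phi> p \<partial>lebesgue_on \<Omega>)" .
qed

lemma weak_partial_unique:
  assumes \<Omega>: "open \<Omega>" and b: "b \<in> Basis" and g: "g \<in> L2 \<Omega>" "has_weak_partial \<Omega> b u g"
    and h: "h \<in> L2 \<Omega>" "has_weak_partial \<Omega> b u h"
  shows "AE x in lebesgue_on \<Omega>. g x = h x"
proof -
  have "AE x in lebesgue_on \<Omega>. g x - h x = 0"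
  proof (rule orthogonal_to_test_functions_imp_AE_0[OF \<Omega> L2_diff[OF g(1) h(1)]])
    fix \<phi> assume \<phi>: "\<phi> \<in> test_functions \<Omega>"
    note int = L2_mult_integrable[OF _ test_functions_L2[OF \<Omega> \<phi>]]
    have "(\<integral>x. g x * \<phi> x \<partial>lebesgue_on \<Omega>) = (\<integral>x. h x * \<phi> x \<partial>lebesgue_on \<Omega>)"
      using g(2) h(2) \<phi> by (simp add: has_weak_partial_def)
    then show "(\<integral>x. (g x - h x) * \<phi> x \<partial>lebesgue_on \<Omega>) = 0"
      using Bochner_Integration.integral_diff[OF int[OF g(1)] int[OF h(1)]]
      by (simp add: left_diff_distrib)
  qed
  then show ?thesis by eventually_elim simp
qed

lemma weak_partial_H1:
  assumes "u \<in> H1 \<Omega>" "b \<in> Basis"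
  shows "weak_partial \<Omega> b u \<in> L2 \<Omega>" "has_weak_partial \<Omega> b u (weak_partial \<Omega> b u)"
proof -
  have "\<exists>g. g \<in> L2 \<Omega> \<and> has_weak_partial \<Omega> b u g" using assms by (auto simp: H1_def)
  from someI_ex[OF this] show "weak_partial \<Omega> b u \<in> L2 \<Omega>"
      "has_weak_partial \<Omega> b u (weak_partial \<Omega> b u)"
    by (simp_all add: weak_partial_def)
qed

lemma H01D:
  assumes "u \<in> H01 \<Omega>"
  shows "u \<in> H1 \<Omega>" "u \<in> L2 \<Omega>"
  using assms by (auto simp: H01_def H1_def)

lemma H01_approx:
  assumes "u \<in> H01 \<Omega>"
  obtains \<phi> where "\<And>n::nat. \<phi> n \<in> test_functions \<Omega>"
    "(\<lambda>n. L2_norm \<Omega> (\<lambda>x. u x - \<phi> n x)) \<longlonglongrightarrow> 0"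
    "\<And>b. b \<in> Basis \<Longrightarrow> (\<lambda>n. L2_norm \<Omega> (\<lambda>x. weak_partial \<Omega> b u x - partial b (\<phi> n) x)) \<longlonglongrightarrow> 0"
  using assms that unfolding H01_def by blast

section \<open>Lower bound for the eigenvalues\<close>

text \<open>
  Jacobi's trick: \<open>sin (c (t - a))\<close> is the positive solution of \<open>y'' = - c\<^sup>2 y\<close> on the interval, and with
  its logarithmic derivative \<open>k = c cot (c (t - a))\<close> the integrand is the square \<open>|g' - k g|\<^sup>2\<close> plus the
  derivative of \<open>k |g|\<^sup>2\<close>. Since \<open>g\<close> is supported inside the interval, the poles of \<open>k\<close> do no harm.
\<close>
lemma Wirtinger_inequality:
  fixes g g' :: "real \<Rightarrow> complex"
  assumes deriv: "\<And>t. (g has_vector_derivative g' t) (at t)" and cont: "continuous_on UNIV g'"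
    and c: "0 < c" and ab: "a < a'" "a' \<le> b'" "b' < a + pi / c"
    and supp: "\<And>t. t \<le> a' \<or> b' \<le> t \<Longrightarrow> g t = 0 \<and> g' t = 0"
  shows "0 \<le> (\<integral>t. (cmod (g' t))\<^sup>2 - c\<^sup>2 * (cmod (g t))\<^sup>2 \<partial>lborel)"
proof -
  define k where "k t = c * cot (c * (t - a))" for t
  define k' where "k' t = - c\<^sup>2 * inverse ((sin (c * (t - a)))\<^sup>2)" for t
  have sin: "sin (c * (t - a)) > 0" if "t \<in> {a'..b'}" for t
  proof (rule sin_gt_zero)
    show "0 < c * (t - a)" using that ab c by simp
    have "t - a < pi / c" using that ab by auto
    then show "c * (t - a) < pi" using c by (simp add: field_simps)
  qed
  have dk: "(k has_real_derivative k' t) (at t)" if "t \<in> {a'..b'}" for t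
  proof -
    have "((\<lambda>t. c * (t - a)) has_real_derivative c) (at t)"
      by (auto intro!: derivative_eq_intros)
    from DERIV_cmult[OF DERIV_chain2[OF DERIV_cot this], of c]
    show ?thesis
      using sin[OF that] unfolding k_def k'_def by (simp add: power2_eq_square algebra_simps)
  qed
  have contg: "continuous_on UNIV g"
    using deriv by (intro continuous_at_imp_continuous_on ballI) (rule has_vector_derivative_continuous)
  have contk: "continuous_on {a'..b'} k"
    by (rule continuous_at_imp_continuous_on) (use dk DERIV_isCont in blast)
  have contk': "continuous_on {a'..b'} k'"
    unfolding k'_def using sin by (intro continuous_intros) force
  note cg = continuous_on_subset[OF contg subset_UNIV] continuous_on_subset[OF cont subset_UNIV]
  define G' where "G' t = k' t * (g t \<bullet> g t) + k t * (2 * (g t \<bullet> g' t))" for t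
  have dG: "((\<lambda>t. k t * (g t \<bullet> g t)) has_vector_derivative G' t) (at t within {a'..b'})"
    if "t \<in> {a'..b'}" for t
  proof -
    have "((\<lambda>t. g t \<bullet> g t) has_vector_derivative g t \<bullet> g' t + g' t \<bullet> g t) (at t)"
      by (rule bounded_bilinear.has_vector_derivative[OF bounded_bilinear_inner deriv deriv])
    then have "((\<lambda>t. g t \<bullet> g t) has_real_derivative 2 * (g t \<bullet> g' t)) (at t)"
      by (simp add: has_real_derivative_iff_has_vector_derivative inner_commute)
    from DERIV_mult[OF dk[OF that] this]
    have "((\<lambda>t. k t * (g t \<bullet> g t)) has_real_derivative G' t) (at t)"
      by (simp add: G'_def algebra_simps)
    then show ?thesis
      by (simp add: has_real_derivative_iff_has_vector_derivative has_vector_derivative_at_within)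
  qed
  have contG: "continuous_on {a'..b'} G'"
    unfolding G'_def by (intro continuous_intros contk contk' cg)
  have FTC: "has_bochner_integral lborel (\<lambda>t. indicator {a'..b'} t *\<^sub>R G' t)
      (k b' * (g b' \<bullet> g b') - k a' * (g a' \<bullet> g a'))"
    by (rule has_bochner_integral_FTC_Icc[OF ab(2)]) (auto intro: dG contG)
  define I where "I t = (cmod (g' t))\<^sup>2 - c\<^sup>2 * (cmod (g t))\<^sup>2" for t
  have I: "I t = indicator {a'..b'} t *\<^sub>R I t" for t
  proof (cases "t \<in> {a'..b'}")
    case False
    then show ?thesis using supp[of t] by (auto simp: I_def)
  qed simp
  \<comment> \<open>completing the square, with \<open>k\<^sup>2 + c\<^sup>2 = - k'\<close>\<close>
  have square: "I t = (norm (g' t - k t *\<^sub>R g t))\<^sup>2 + G' t" if "t \<in> {a'..b'}" for t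
  proof -
    have s: "sin (c * (t - a)) \<noteq> 0" using sin[OF that] by simp
    have "(cos y)\<^sup>2 / (sin y)\<^sup>2 + 1 = inverse ((sin y)\<^sup>2)" if "sin y \<noteq> 0" for y :: real
      using that sin_cos_squared_add2[of y] by (simp add: field_simps)
    from arg_cong[OF this[OF s], of "\<lambda>r. c\<^sup>2 * r"]
    have kk: "(k t)\<^sup>2 + c\<^sup>2 = - k' t"
      by (simp add: k_def k'_def cot_def power_divide power_mult_distrib distrib_left)
    have "(norm (g' t - k t *\<^sub>R g t))\<^sup>2
        = (cmod (g' t))\<^sup>2 - 2 * k t * (g t \<bullet> g' t) + (k t)\<^sup>2 * (cmod (g t))\<^sup>2"
      unfolding power2_norm_eq_inner
      by (simp add: inner_diff_left inner_diff_right inner_commute power2_eq_square algebra_simps)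
    moreover have "k' t * (g t \<bullet> g t) = - ((k t)\<^sup>2 + c\<^sup>2) * (cmod (g t))\<^sup>2"
      unfolding kk by (simp add: power2_norm_eq_inner)
    ultimately show ?thesis by (simp add: I_def G'_def algebra_simps)
  qed
  have "0 = (\<integral>t. indicator {a'..b'} t *\<^sub>R G' t \<partial>lborel)"
    using has_bochner_integral_integral_eq[OF FTC] supp[of a'] supp[of b'] by simp
  also have "\<dots> \<le> (\<integral>t. indicator {a'..b'} t *\<^sub>R I t \<partial>lborel)"
  proof (rule integral_mono)
    show "integrable lborel (\<lambda>t. indicator {a'..b'} t *\<^sub>R G' t)"
      using FTC by (rule integrable.intros)
    show "integrable lborel (\<lambda>t. indicator {a'..b'} t *\<^sub>R I t)"
      unfolding I_def by (intro borel_integrable_compact continuous_intros cg) auto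
    show "indicator {a'..b'} t *\<^sub>R G' t \<le> indicator {a'..b'} t *\<^sub>R I t" for t
      using square[of t] by (auto simp: indicator_def)
  qed
  also have "\<dots> = (\<integral>t. I t \<partial>lborel)" by (simp only: I[symmetric])
  finally show ?thesis by (simp add: I_def)
qed

lemma compact_subset_open_interval:
  fixes K :: "real set"
  assumes "compact K" "K \<subseteq> {a<..<b}" "a < b"
  obtains a' b' where "a < a'" "a' \<le> b'" "b' < b" "K \<subseteq> {a'<..<b'}"
proof (cases "K = {}")
  case True
  then show ?thesis using assms(3) by (intro that[of "(a + b) / 2" "(a + b) / 2"]) auto
next
  case False
  obtain m where m: "m \<in> K" "\<And>t. t \<in> K \<Longrightarrow> m \<le> t" using compact_attains_inf[OF assms(1) False] by blast
  obtain M where M: "M \<in> K" "\<And>t. t \<in> K \<Longrightarrow> t \<le> M" using compact_attains_sup[OF assms(1) False] by blast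
  have "a < m" "M < b" "m \<le> M" using assms(2) m M by auto
  then show ?thesis
    using m(2) M(2) by (intro that[of "(a + m) / 2" "(M + b) / 2"]) (auto, (smt (verit) field_sum_of_halves)+)
qed

text \<open>
  The vertical slices are intervals of the constant length \<open>1 / sin \<alpha>\<close>, also across the corner.
\<close>
lemma V_waveguide_slice:
  assumes "0 < sin \<alpha>"
  shows "(x, z) \<in> V_waveguide \<alpha> \<longleftrightarrow>
    z \<in> {\<bar>x\<bar> * cos \<alpha> / sin \<alpha> <..< \<bar>x\<bar> * cos \<alpha> / sin \<alpha> + 1 / sin \<alpha>}"
proof -
  have "\<bar>x\<bar> * cos \<alpha> / sin \<alpha> + 1 / sin \<alpha> = (\<bar>x\<bar> * cos \<alpha> + 1) / sin \<alpha>"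
    by (simp add: add_divide_distrib)
  then show ?thesis
    using assms by (auto simp: V_waveguide_def pos_less_divide_eq pos_divide_less_eq)
qed

lemma open_V_waveguide: "open (V_waveguide \<alpha>)"
proof -
  have "V_waveguide \<alpha> = {p. 0 < snd p * sin \<alpha> - \<bar>fst p\<bar> * cos \<alpha>}
      \<inter> {p. snd p * sin \<alpha> - \<bar>fst p\<bar> * cos \<alpha> < 1}"
    by (auto simp: V_waveguide_def)
  then show ?thesis
    by (auto intro!: open_Int open_Collect_less continuous_intros)
qed

lemma V_waveguide_test_function_Poincare:
  assumes \<alpha>: "\<alpha> \<in> {0<..<pi / 2}" and \<phi>: "\<phi> \<in> test_functions (V_waveguide \<alpha>)"
  shows "pi * sin \<alpha> * L2_norm (V_waveguide \<alpha>) \<phi> \<le> L2_norm (V_waveguide \<alpha>) (partial (0, 1) \<phi>)"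
proof -
  let ?\<Omega> = "V_waveguide \<alpha>"
  let ?\<phi>' = "partial (0, 1) \<phi>"
  have s: "0 < sin \<alpha>" using \<alpha> by (intro sin_gt_zero) auto
  define c where "c = pi * sin \<alpha>"
  have c: "0 < c" using s by (simp add: c_def)
  have b: "(0, 1) \<in> (Basis :: (real \<times> real) set)" by (simp add: Basis_plane)
  note \<phi>' = test_function_partial[OF \<phi> b]
  note cont = smooth_continuous[OF test_functionsD(1)[OF \<phi>]] smooth_continuous[OF test_functionsD(1)[OF \<phi>']]
  have int: "integrable lborel (\<lambda>p. (cmod (f p))\<^sup>2)"
    and norm: "(L2_norm ?\<Omega> f)\<^sup>2 = (\<integral>p. (cmod (f p))\<^sup>2 \<partial>lborel)"
    if f: "f \<in> test_functions ?\<Omega>" for f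
  proof -
    have cont: "continuous_on UNIV (\<lambda>p. (cmod (f p))\<^sup>2)"
      by (intro continuous_intros smooth_continuous[OF test_functionsD(1)[OF f]])
    show "integrable lborel (\<lambda>p. (cmod (f p))\<^sup>2)"
      by (rule integrable_continuous_bounded_support[OF cont]) (simp add: test_functionsD(2)[OF f])
    show "(L2_norm ?\<Omega> f)\<^sup>2 = (\<integral>p. (cmod (f p))\<^sup>2 \<partial>lborel)"
      unfolding L2_norm_square
      by (rule integral_lebesgue_on_support[OF open_V_waveguide cont])
         (simp add: test_functionsD(4)[OF f])
  qed
  have slice: "0 \<le> (\<integral>z. (cmod (?\<phi>' (x, z)))\<^sup>2 - c\<^sup>2 * (cmod (\<phi> (x, z)))\<^sup>2 \<partial>lborel)" for x
  proof -
    let ?S = "closure {p. \<phi> p \<noteq> 0}"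
    define K where "K = {z. (x, z) \<in> ?S}"
    have "K = snd ` (?S \<inter> ({x} \<times> UNIV))" by (force simp: K_def)
    moreover have "compact (?S \<inter> ({x} \<times> UNIV))"
      using test_functionsD(2)[OF \<phi>] by (intro compact_Int_closed closed_Times) auto
    ultimately have "compact K"
      by (simp add: compact_continuous_image continuous_on_snd)
    moreover define a where "a = \<bar>x\<bar> * cos \<alpha> / sin \<alpha>"
    have len: "pi / c = 1 / sin \<alpha>" by (simp add: c_def)
    have "K \<subseteq> {a <..< a + pi / c}"
      using test_functionsD(3)[OF \<phi>] unfolding K_def len a_def
      by (auto simp: V_waveguide_slice[OF s] subset_eq)
    ultimately obtain a' b' where ab: "a < a'" "a' \<le> b'" "b' < a + pi / c" "K \<subseteq> {a'<..<b'}"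
      using compact_subset_open_interval[of K a "a + pi / c"] c by auto
    show ?thesis
    proof (rule Wirtinger_inequality[OF _ _ c ab(1-3)])
      show "((\<lambda>z. \<phi> (x, z)) has_vector_derivative ?\<phi>' (x, z)) (at z)" for z
        by (rule smooth_slice(1)[OF test_functionsD(1)[OF \<phi>]])
      show "continuous_on UNIV (\<lambda>z. ?\<phi>' (x, z))"
        by (rule continuous_on_compose2[OF cont(2)]) (auto intro: continuous_intros)
      show "\<phi> (x, z) = 0 \<and> ?\<phi>' (x, z) = 0" if "z \<le> a' \<or> b' \<le> z" for z
      proof -
        have "(x, z) \<notin> ?S" using that ab(4) by (auto simp: K_def)
        then show ?thesis
          using closure_subset[of "{p. \<phi> p \<noteq> 0}"]
            partial_support[where f = \<phi> and b = "(0, 1)"] by auto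
      qed
    qed
  qed
  have "0 \<le> (\<integral>p. (cmod (?\<phi>' p))\<^sup>2 - c\<^sup>2 * (cmod (\<phi> p))\<^sup>2 \<partial>lborel)"
    by (subst integral_plane_iterated(1)) (auto intro!: Bochner_Integration.integral_nonneg slice int \<phi> \<phi>')
  also have "\<dots> = (L2_norm ?\<Omega> ?\<phi>')\<^sup>2 - c\<^sup>2 * (L2_norm ?\<Omega> \<phi>)\<^sup>2"
    using int[OF \<phi>] int[OF \<phi>'] by (simp add: norm[OF \<phi>] norm[OF \<phi>'])
  finally have "(c * L2_norm ?\<Omega> \<phi>)\<^sup>2 \<le> (L2_norm ?\<Omega> ?\<phi>')\<^sup>2"
    by (simp add: power_mult_distrib)
  then show ?thesis
    unfolding c_def by (rule power2_le_imp_le) (rule L2_norm_nonneg)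
qed

lemma V_waveguide_H01_Poincare:
  assumes \<alpha>: "\<alpha> \<in> {0<..<pi / 2}" and u: "u \<in> H01 (V_waveguide \<alpha>)"
  shows "pi * sin \<alpha> * L2_norm (V_waveguide \<alpha>) u
    \<le> L2_norm (V_waveguide \<alpha>) (weak_partial (V_waveguide \<alpha>) (0, 1) u)"
proof -
  let ?\<Omega> = "V_waveguide \<alpha>"
  obtain \<phi> where \<phi>: "\<And>n::nat. \<phi> n \<in> test_functions ?\<Omega>"
    "(\<lambda>n. L2_norm ?\<Omega> (\<lambda>x. u x - \<phi> n x)) \<longlonglongrightarrow> 0"
    "\<And>b. b \<in> Basis \<Longrightarrow> (\<lambda>n. L2_norm ?\<Omega> (\<lambda>x. weak_partial ?\<Omega> b u x - partial b (\<phi> n) x)) \<longlonglongrightarrow> 0"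
    using H01_approx[OF u] by blast
  have b: "(0, 1) \<in> (Basis :: (real \<times> real) set)" by (simp add: Basis_plane)
  have "(\<lambda>n. L2_norm ?\<Omega> (\<phi> n)) \<longlonglongrightarrow> L2_norm ?\<Omega> u"
    by (rule L2_norm_tendsto[OF H01D(2)[OF u] test_functions_L2[OF open_V_waveguide \<phi>(1)] \<phi>(2)])
  moreover have "(\<lambda>n. L2_norm ?\<Omega> (partial (0, 1) (\<phi> n)))
      \<longlonglongrightarrow> L2_norm ?\<Omega> (weak_partial ?\<Omega> (0, 1) u)"
    by (rule L2_norm_tendsto[OF weak_partial_H1(1)[OF H01D(1)[OF u] b]
        test_functions_L2[OF open_V_waveguide test_function_partial[OF \<phi>(1) b]] \<phi>(3)[OF b]])
  ultimately show ?thesis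
    using V_waveguide_test_function_Poincare[OF \<alpha> \<phi>(1)]
    by (intro LIMSEQ_le[OF tendsto_mult_left]) auto
qed

text \<open>
  At an eigenfunction the form equals \<open>l \<parallel>u\<parallel>\<^sup>2\<close>; the vertical derivative alone yields the bound.
\<close>
lemma eigenvalue_ge:
  assumes \<alpha>: "\<alpha> \<in> {0<..<pi / 2}"
    and ev: "is_eigenvalue (V_waveguide \<alpha>) (Dirichlet_Laplacian (V_waveguide \<alpha>)) (complex_of_real l)"
  shows "pi\<^sup>2 * (sin \<alpha>)\<^sup>2 \<le> l"
proof -
  let ?\<Omega> = "V_waveguide \<alpha>"
  obtain u f where u: "u \<in> H01 ?\<Omega>" and f: "f \<in> L2 ?\<Omega>"
    and form: "\<And>v. v \<in> H01 ?\<Omega> \<Longrightarrow> Dirichlet_form ?\<Omega> u v = L2_inner ?\<Omega> f v"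
    and fu: "AE x in lebesgue_on ?\<Omega>. f x = complex_of_real l * u x"
    and nz: "\<not> (AE x in lebesgue_on ?\<Omega>. u x = 0)"
    using ev by (auto simp: is_eigenvalue_def eigenspace_def Dirichlet_Laplacian_def)
  note uL2 = H01D(2)[OF u]
  have "(L2_norm ?\<Omega> u)\<^sup>2 \<noteq> 0"
  proof
    assume "(L2_norm ?\<Omega> u)\<^sup>2 = 0"
    then have "AE x in lebesgue_on ?\<Omega>. (cmod (u x))\<^sup>2 = 0"
      unfolding L2_norm_square
      by (subst (asm) integral_nonneg_eq_0_iff_AE[OF L2_integrable[OF uL2]]) auto
    then show False using nz by simp
  qed
  then have pos: "0 < (L2_norm ?\<Omega> u)\<^sup>2" by simp
  have "complex_of_real (\<Sum>b\<in>Basis. (L2_norm ?\<Omega> (weak_partial ?\<Omega> b u))\<^sup>2) = L2_inner ?\<Omega> f u"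
    using form[OF u] by (simp add: Dirichlet_form_def L2_inner_self)
  also have "\<dots> = (\<integral>x. complex_of_real l * (u x * cnj (u x)) \<partial>lebesgue_on ?\<Omega>)"
    unfolding L2_inner_def
  proof (rule integral_cong_AE)
    show "(\<lambda>x. f x * cnj (u x)) \<in> borel_measurable (lebesgue_on ?\<Omega>)"
      using L2_inner_integrable[OF f uL2] by (rule borel_measurable_integrable)
    show "(\<lambda>x. complex_of_real l * (u x * cnj (u x))) \<in> borel_measurable (lebesgue_on ?\<Omega>)"
      using L2_inner_integrable[OF uL2 uL2] by (intro borel_measurable_integrable integrable_mult_right)
    show "AE x in lebesgue_on ?\<Omega>. f x * cnj (u x) = complex_of_real l * (u x * cnj (u x))"
      using fu by eventually_elim simp
  qed
  also have "\<dots> = complex_of_real (l * (L2_norm ?\<Omega> u)\<^sup>2)"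
    using L2_inner_self[of ?\<Omega> u] by (simp add: L2_inner_def)
  finally have energy: "(\<Sum>b\<in>Basis. (L2_norm ?\<Omega> (weak_partial ?\<Omega> b u))\<^sup>2) = l * (L2_norm ?\<Omega> u)\<^sup>2"
    by (simp only: of_real_eq_iff)
  have s: "0 < sin \<alpha>" using \<alpha> by (intro sin_gt_zero) auto
  have "pi\<^sup>2 * (sin \<alpha>)\<^sup>2 * (L2_norm ?\<Omega> u)\<^sup>2 = (pi * sin \<alpha> * L2_norm ?\<Omega> u)\<^sup>2"
    by (simp add: power_mult_distrib)
  also have "\<dots> \<le> (L2_norm ?\<Omega> (weak_partial ?\<Omega> (0, 1) u))\<^sup>2"
    using s by (intro power_mono V_waveguide_H01_Poincare[OF \<alpha> u]) (simp add: L2_norm_nonneg)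
  also have "\<dots> \<le> l * (L2_norm ?\<Omega> u)\<^sup>2"
    unfolding energy[symmetric] by (simp add: Basis_plane)
  finally show ?thesis using pos by simp
qed

section \<open>Smooth functions in the domain of the Dirichlet Laplacian\<close>

lemma smooth_H1:
  fixes u :: "real \<times> real \<Rightarrow> complex"
  assumes "open \<Omega>" "smooth u" "u \<in> L2 \<Omega>" "\<And>b. b \<in> Basis \<Longrightarrow> partial b u \<in> L2 \<Omega>"
  shows "u \<in> H1 \<Omega>"
  using assms smooth_has_weak_partial[OF assms(1,2)] unfolding H1_def by blast

lemma smooth_weak_partial_eq:
  fixes u :: "real \<times> real \<Rightarrow> complex"
  assumes "open \<Omega>" "smooth u" "u \<in> H1 \<Omega>" "b \<in> Basis" "partial b u \<in> L2 \<Omega>"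
  shows "AE x in lebesgue_on \<Omega>. weak_partial \<Omega> b u x = partial b u x"
  using weak_partial_unique[OF assms(1,4) weak_partial_H1[OF assms(3,4)] assms(5)
      smooth_has_weak_partial[OF assms(1,2,4)]] .

text \<open>
  The definition of \<open>H\<^sub>0\<^sup>1\<close> measures the distance to the chosen weak derivative, which here agrees
  almost everywhere with the classical one.
\<close>
lemma smooth_H01:
  fixes u :: "real \<times> real \<Rightarrow> complex"
  assumes \<Omega>: "open \<Omega>" and u: "smooth u" "u \<in> L2 \<Omega>" "\<And>b. b \<in> Basis \<Longrightarrow> partial b u \<in> L2 \<Omega>"
    and \<phi>: "\<And>n::nat. \<phi> n \<in> test_functions \<Omega>"
    and lim: "(\<lambda>n. L2_norm \<Omega> (\<lambda>x. u x - \<phi> n x)) \<longlonglongrightarrow> 0"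
    and lim': "\<And>b. b \<in> Basis \<Longrightarrow> (\<lambda>n. L2_norm \<Omega> (\<lambda>x. partial b u x - partial b (\<phi> n) x)) \<longlonglongrightarrow> 0"
  shows "u \<in> H01 \<Omega>"
proof -
  have H1: "u \<in> H1 \<Omega>" by (rule smooth_H1[OF \<Omega> u])
  have "L2_norm \<Omega> (\<lambda>x. weak_partial \<Omega> b u x - partial b (\<phi> n) x)
      = L2_norm \<Omega> (\<lambda>x. partial b u x - partial b (\<phi> n) x)" if b: "b \<in> Basis" for b n
  proof (rule L2_norm_cong_AE)
    have \<phi>': "partial b (\<phi> n) \<in> L2 \<Omega>"
      by (rule test_functions_L2[OF \<Omega> test_function_partial[OF \<phi> b]])
    show "(\<lambda>x. weak_partial \<Omega> b u x - partial b (\<phi> n) x) \<in> L2 \<Omega>"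
      by (rule L2_diff[OF weak_partial_H1(1)[OF H1 b] \<phi>'])
    show "(\<lambda>x. partial b u x - partial b (\<phi> n) x) \<in> L2 \<Omega>"
      by (rule L2_diff[OF u(3)[OF b] \<phi>'])
    show "AE x in lebesgue_on \<Omega>. weak_partial \<Omega> b u x - partial b (\<phi> n) x
        = partial b u x - partial b (\<phi> n) x"
      using smooth_weak_partial_eq[OF \<Omega> u(1) H1 b u(3)[OF b]] by eventually_elim simp
  qed
  then have "\<forall>b\<in>Basis. (\<lambda>n. L2_norm \<Omega> (\<lambda>x. weak_partial \<Omega> b u x - partial b (\<phi> n) x)) \<longlonglongrightarrow> 0"
    using lim' by (intro ballI) (simp only:)
  then have "(\<forall>n. \<phi> n \<in> test_functions \<Omega>) \<and> (\<lambda>n. L2_norm \<Omega> (\<lambda>x. u x - \<phi> n x)) \<longlonglongrightarrow> 0 \<and>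
      (\<forall>b\<in>Basis. (\<lambda>n. L2_norm \<Omega> (\<lambda>x. weak_partial \<Omega> b u x - partial b (\<phi> n) x)) \<longlonglongrightarrow> 0)"
    using \<phi> lim by blast
  then show ?thesis
    unfolding H01_def using H1 by blast
qed

lemma L2_inner_cong_AE_left:
  assumes "u \<in> L2 \<Omega>" "u' \<in> L2 \<Omega>" "v \<in> L2 \<Omega>" "AE x in lebesgue_on \<Omega>. u x = u' x"
  shows "L2_inner \<Omega> u v = L2_inner \<Omega> u' v"
  unfolding L2_inner_def
proof (rule integral_cong_AE)
  show "AE x in lebesgue_on \<Omega>. u x * cnj (v x) = u' x * cnj (v x)"
    using assms(4) by eventually_elim simp
qed (use assms in \<open>auto intro: borel_measurable_integrable L2_inner_integrable\<close>)

lemma L2_inner_partial: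
  fixes f \<phi> :: "real \<times> real \<Rightarrow> complex"
  assumes \<Omega>: "open \<Omega>" and f: "smooth f" and \<phi>: "\<phi> \<in> test_functions \<Omega>" and b: "b \<in> Basis"
  shows "L2_inner \<Omega> f (partial b \<phi>) = - L2_inner \<Omega> (partial b f) \<phi>"
proof -
  have cnj: "partial b (\<lambda>x. cnj (\<phi> x)) x = cnj (partial b \<phi> x)" for x
    by (rule partial_cnj[OF smooth_differentiable[OF test_functionsD(1)[OF \<phi>]]])
  have "(\<lambda>x. cnj (\<phi> x)) \<in> test_functions \<Omega>"
    by (rule test_functionsI[where K = "closure {x. \<phi> x \<noteq> 0}"])
       (use test_functionsD[OF \<phi>] closure_subset[of "{x. \<phi> x \<noteq> 0}"] in \<open>auto intro: smooth_cnj\<close>)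
  from bspec[OF smooth_has_weak_partial[OF \<Omega> f b, unfolded has_weak_partial_def] this]
  show ?thesis unfolding L2_inner_def by (simp only: cnj)
qed

text \<open>
  Approximating the second argument of the form by test functions reduces the claim to integration by
  parts without boundary terms.
\<close>
lemma smooth_Dirichlet_Laplacian:
  fixes u :: "real \<times> real \<Rightarrow> complex"
  assumes \<Omega>: "open \<Omega>" and u: "smooth u" "u \<in> H01 \<Omega>"
    and u': "\<And>b. b \<in> Basis \<Longrightarrow> partial b u \<in> L2 \<Omega>"
    and u'': "\<And>b. b \<in> Basis \<Longrightarrow> partial b (partial b u) \<in> L2 \<Omega>"
  shows "(u, \<lambda>x. - (\<Sum>b\<in>Basis. partial b (partial b u) x)) \<in> Dirichlet_Laplacian \<Omega>"
proof -
  have form: "L2_inner \<Omega> (weak_partial \<Omega> b u) (weak_partial \<Omega> b v)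
      = - L2_inner \<Omega> (partial b (partial b u)) v" if b: "b \<in> Basis" and v: "v \<in> H01 \<Omega>" for b v
  proof -
    obtain \<phi> where \<phi>: "\<And>n::nat. \<phi> n \<in> test_functions \<Omega>"
      "(\<lambda>n. L2_norm \<Omega> (\<lambda>x. v x - \<phi> n x)) \<longlonglongrightarrow> 0"
      "\<And>b. b \<in> Basis \<Longrightarrow> (\<lambda>n. L2_norm \<Omega> (\<lambda>x. weak_partial \<Omega> b v x - partial b (\<phi> n) x)) \<longlonglongrightarrow> 0"
      using H01_approx[OF v] by blast
    note wv = weak_partial_H1(1)[OF H01D(1)[OF v] b]
    have "(\<lambda>n. L2_inner \<Omega> (partial b u) (partial b (\<phi> n)))
        \<longlonglongrightarrow> L2_inner \<Omega> (partial b u) (weak_partial \<Omega> b v)"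
      by (rule L2_inner_tendsto_right[OF u'[OF b] wv
          test_functions_L2[OF \<Omega> test_function_partial[OF \<phi>(1) b]] \<phi>(3)[OF b]])
    moreover have "(\<lambda>n. - L2_inner \<Omega> (partial b (partial b u)) (\<phi> n))
        \<longlonglongrightarrow> - L2_inner \<Omega> (partial b (partial b u)) v"
      by (intro tendsto_minus L2_inner_tendsto_right[OF u''[OF b] H01D(2)[OF v]
          test_functions_L2[OF \<Omega> \<phi>(1)] \<phi>(2)])
    ultimately have "L2_inner \<Omega> (partial b u) (weak_partial \<Omega> b v)
        = - L2_inner \<Omega> (partial b (partial b u)) v"
      unfolding L2_inner_partial[OF \<Omega> smooth_partial[OF u(1) b] \<phi>(1) b] by (rule LIMSEQ_unique)
    then show ?thesis
      using L2_inner_cong_AE_left[OF weak_partial_H1(1)[OF H01D(1)[OF u(2)] b] u'[OF b] wv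
          smooth_weak_partial_eq[OF \<Omega> u(1) H01D(1)[OF u(2)] b u'[OF b]]] by simp
  qed
  have sum: "(\<lambda>x. - (\<Sum>b\<in>B. partial b (partial b u) x)) \<in> L2 \<Omega>
      \<and> (\<forall>v\<in>L2 \<Omega>. L2_inner \<Omega> (\<lambda>x. - (\<Sum>b\<in>B. partial b (partial b u) x)) v
        = (\<Sum>b\<in>B. - L2_inner \<Omega> (partial b (partial b u)) v))"
    if "finite B" "B \<subseteq> Basis" for B
  proof
    show "(\<lambda>x. - (\<Sum>b\<in>B. partial b (partial b u) x)) \<in> L2 \<Omega>"
      using that
    proof (induction B rule: finite_induct)
      case empty
      then show ?case by (simp add: L2_def)
    next
      case (insert b B)
      then have "(\<lambda>x. - (\<Sum>b\<in>B. partial b (partial b u) x) - partial b (partial b u) x) \<in> L2 \<Omega>"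
        by (intro L2_diff u'') auto
      moreover have "(\<lambda>x. - (\<Sum>b\<in>insert b B. partial b (partial b u) x))
          = (\<lambda>x. - (\<Sum>b\<in>B. partial b (partial b u) x) - partial b (partial b u) x)"
        using insert.hyps by (simp add: fun_eq_iff)
      ultimately show ?case by (simp only:)
    qed
    show "\<forall>v\<in>L2 \<Omega>. L2_inner \<Omega> (\<lambda>x. - (\<Sum>b\<in>B. partial b (partial b u) x)) v
        = (\<Sum>b\<in>B. - L2_inner \<Omega> (partial b (partial b u)) v)"
    proof
      fix v assume v: "v \<in> L2 \<Omega>"
      have "L2_inner \<Omega> (\<lambda>x. - (\<Sum>b\<in>B. partial b (partial b u) x)) v
          = (\<integral>x. (\<Sum>b\<in>B. - (partial b (partial b u) x * cnj (v x))) \<partial>lebesgue_on \<Omega>)"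
        unfolding L2_inner_def by (simp add: sum_distrib_right sum_negf)
      also have "\<dots> = (\<Sum>b\<in>B. \<integral>x. - (partial b (partial b u) x * cnj (v x)) \<partial>lebesgue_on \<Omega>)"
        using that by (intro Bochner_Integration.integral_sum)
          (auto intro!: L2_inner_integrable u'' v)
      finally show "L2_inner \<Omega> (\<lambda>x. - (\<Sum>b\<in>B. partial b (partial b u) x)) v
          = (\<Sum>b\<in>B. - L2_inner \<Omega> (partial b (partial b u)) v)"
        by (simp add: L2_inner_def)
    qed
  qed
  have "Dirichlet_form \<Omega> u v = L2_inner \<Omega> (\<lambda>x. - (\<Sum>b\<in>Basis. partial b (partial b u) x)) v"
    if v: "v \<in> H01 \<Omega>" for v
    using sum[OF finite_Basis subset_refl] H01D(2)[OF v] form[OF _ v]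
    by (simp add: Dirichlet_form_def)
  then show ?thesis
    using u(2) sum[OF finite_Basis subset_refl] by (auto simp: Dirichlet_Laplacian_def)
qed

lemma L2_norm_tendsto_0:
  fixes f :: "nat \<Rightarrow> 'a::euclidean_space \<Rightarrow> complex"
  assumes \<Omega>: "open \<Omega>" and cont: "\<And>m. continuous_on UNIV (f m)" and S: "bounded S"
    and supp: "\<And>m x. x \<in> \<Omega> \<Longrightarrow> x \<notin> S \<Longrightarrow> f m x = 0"
    and bound: "\<And>m x. x \<in> \<Omega> \<Longrightarrow> cmod (f m x) \<le> K"
    and lim: "\<And>x. x \<in> \<Omega> \<Longrightarrow> (\<lambda>m. f m x) \<longlonglongrightarrow> 0"
  shows "(\<lambda>m. L2_norm \<Omega> (f m)) \<longlonglongrightarrow> 0"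
proof -
  have [measurable]: "\<Omega> \<in> sets borel" using \<Omega> by simp
  have [measurable]: "f m \<in> borel_measurable borel" for m
    by (rule borel_measurable_continuous_onI[OF cont])
  obtain a b where ab: "S \<subseteq> cbox a b" using bounded_subset_cbox_symmetric[OF S] by blast
  have "(\<lambda>m. \<integral>x. indicator \<Omega> x *\<^sub>R (cmod (f m x))\<^sup>2 \<partial>lborel) \<longlonglongrightarrow> (\<integral>x. 0 \<partial>(lborel :: 'a measure))"
  proof (rule integral_dominated_convergence[where w = "\<lambda>x. K\<^sup>2 * indicator (cbox a b) x"])
    show "integrable lborel (\<lambda>x. K\<^sup>2 * indicator (cbox a b) x)"
      by (intro integrable_mult_right integrable_real_indicator)
         (simp_all add: emeasure_lborel_cbox_finite[simplified])
    show "AE x in lborel. (\<lambda>m. indicator \<Omega> x *\<^sub>R (cmod (f m x))\<^sup>2) \<longlonglongrightarrow> 0"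
    proof (rule AE_I2)
      fix x
      show "(\<lambda>m. indicator \<Omega> x *\<^sub>R (cmod (f m x))\<^sup>2) \<longlonglongrightarrow> 0"
      proof (cases "x \<in> \<Omega>")
        case True
        have "(\<lambda>m. (cmod (f m x))\<^sup>2) \<longlonglongrightarrow> 0\<^sup>2"
          by (intro tendsto_power tendsto_norm_zero lim True)
        then show ?thesis using True by simp
      qed simp
    qed
    show "AE x in lborel. norm (indicator \<Omega> x *\<^sub>R (cmod (f m x))\<^sup>2) \<le> K\<^sup>2 * indicator (cbox a b) x" for m
    proof (rule AE_I2)
      fix x
      show "norm (indicator \<Omega> x *\<^sub>R (cmod (f m x))\<^sup>2) \<le> K\<^sup>2 * indicator (cbox a b) x"
        using supp[of x m] bound[of x m] ab by (auto simp: indicator_def intro: power_mono)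
    qed
  qed measurable
  then have "(\<lambda>m. (L2_norm \<Omega> (f m))\<^sup>2) \<longlonglongrightarrow> 0"
    by (simp add: L2_norm_square integral_lebesgue_on_eq_lborel(1)[OF \<Omega>])
  from tendsto_real_sqrt[OF this] show ?thesis by (simp add: L2_norm_nonneg)
qed

section \<open>Waves travelling along one branch\<close>

text \<open>
  Rotated coordinates for the right branch: there the waveguide is the strip in which the coordinate
  across lies between \<open>0\<close> and \<open>1\<close>.
\<close>

definition across :: "real \<Rightarrow> real \<times> real \<Rightarrow> real" where
  "across \<alpha> p = snd p * sin \<alpha> - fst p * cos \<alpha>"

definition along :: "real \<Rightarrow> real \<times> real \<Rightarrow> real" where
  "along \<alpha> p = fst p * sin \<alpha> + snd p * cos \<alpha>"

lemma bounded_linear_across: "bounded_linear (across \<alpha>)"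
  unfolding across_def[abs_def]
  by (intro bounded_linear_sub bounded_linear_mult_const[OF bounded_linear_snd]
      bounded_linear_mult_const[OF bounded_linear_fst])

lemma bounded_linear_along: "bounded_linear (along \<alpha>)"
  unfolding along_def[abs_def]
  by (intro bounded_linear_add bounded_linear_mult_const[OF bounded_linear_snd]
      bounded_linear_mult_const[OF bounded_linear_fst])

lemma across_Basis_le: "b \<in> Basis \<Longrightarrow> \<bar>across \<alpha> b\<bar> \<le> 1"
  by (auto simp: Basis_plane across_def abs_sin_le_one abs_cos_le_one)

lemma along_Basis_le: "b \<in> Basis \<Longrightarrow> \<bar>along \<alpha> b\<bar> \<le> 1"
  by (auto simp: Basis_plane along_def abs_sin_le_one abs_cos_le_one)

lemma V_waveguide_right_branch:
  "0 \<le> fst p \<Longrightarrow> p \<in> V_waveguide \<alpha> \<longleftrightarrow> 0 < across \<alpha> p \<and> across \<alpha> p < 1"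
  by (cases p) (auto simp: V_waveguide_def across_def)

text \<open>
  For \<open>a = 1\<close>, \<open>b = 0\<close> this is the lowest transversal mode with wave number \<open>k\<close>. The cosine is included
  to make the family closed under differentiation.
\<close>
definition wave :: "real \<Rightarrow> real \<Rightarrow> complex \<Rightarrow> complex \<Rightarrow> real \<times> real \<Rightarrow> complex" where
  "wave k \<alpha> a b p = exp (\<i> * complex_of_real (k * along \<alpha> p)) *
     (a * complex_of_real (sin (pi * across \<alpha> p)) + b * complex_of_real (cos (pi * across \<alpha> p)))"

lemma wave_has_derivative:
  fixes a b :: complex
  shows "(wave k \<alpha> a b has_derivative
    (\<lambda>v. wave k \<alpha> (\<i> * k * along \<alpha> v * a - pi * across \<alpha> v * b)
      (\<i> * k * along \<alpha> v * b + pi * across \<alpha> v * a) p)) (at p)"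
proof -
  have "bounded_linear (\<lambda>p. \<i> * complex_of_real (k * along \<alpha> p))"
    by (intro bounded_linear_const_mult bounded_linear_of_real[THEN bounded_linear_compose]
        bounded_linear_along)
  note E = exp_linear_has_derivative[OF this, of p]
  have t: "((\<lambda>p. pi * across \<alpha> p) has_derivative (\<lambda>v. pi * across \<alpha> v)) (at p)"
    by (intro bounded_linear_imp_has_derivative bounded_linear_const_mult bounded_linear_across)
  note S = has_derivative_of_real[OF has_derivative_compose[OF t DERIV_sin[unfolded has_field_derivative_def]]]
  note C = has_derivative_of_real[OF has_derivative_compose[OF t DERIV_cos[unfolded has_field_derivative_def]]]
  have "((\<lambda>p. exp (\<i> * complex_of_real (k * along \<alpha> p)) *
     (a * complex_of_real (sin (pi * across \<alpha> p)) + b * complex_of_real (cos (pi * across \<alpha> p)))) has_derivative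
    (\<lambda>v. wave k \<alpha> (\<i> * k * along \<alpha> v * a - pi * across \<alpha> v * b)
      (\<i> * k * along \<alpha> v * b + pi * across \<alpha> v * a) p)) (at p)"
    by (rule has_derivative_eq_rhs[OF has_derivative_mult[OF E
          has_derivative_add[OF has_derivative_mult_right[OF S] has_derivative_mult_right[OF C]]]])
       (simp add: wave_def fun_eq_iff algebra_simps)
  then show ?thesis by (simp only: wave_def[abs_def])
qed

lemma partial_wave:
  fixes a b :: complex
  shows "partial v (wave k \<alpha> a b) p =
    wave k \<alpha> (\<i> * k * along \<alpha> v * a - pi * across \<alpha> v * b)
      (\<i> * k * along \<alpha> v * b + pi * across \<alpha> v * a) p"
  by (rule partial_eq[OF wave_has_derivative])

lemma smooth_wave: "smooth (wave k \<alpha> a b)"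
proof (rule smooth_coinduct[where S = "range (\<lambda>(a, b). wave k \<alpha> a b)"])
  show "wave k \<alpha> a b \<in> range (\<lambda>(a, b). wave k \<alpha> a b)" by (auto intro!: image_eqI[of _ _ "(a, b)"])
next
  fix g and v x :: "real \<times> real"
  assume "g \<in> range (\<lambda>(a, b). wave k \<alpha> a b)"
  then obtain c d where g: "g = wave k \<alpha> c d" by auto
  show "g differentiable (at x)" unfolding g differentiable_def using wave_has_derivative by blast
  show "partial v g \<in> range (\<lambda>(a, b). wave k \<alpha> a b)"
    unfolding g partial_wave by (rule image_eqI[of _ _ "(_, _)"]) auto
qed

lemma cmod_wave_le: "cmod (wave k \<alpha> a b p) \<le> cmod a + cmod b"
proof -
  have "cmod (a * complex_of_real (sin (pi * across \<alpha> p)) + b * complex_of_real (cos (pi * across \<alpha> p)))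
      \<le> cmod a * \<bar>sin (pi * across \<alpha> p)\<bar> + cmod b * \<bar>cos (pi * across \<alpha> p)\<bar>"
    by (rule norm_triangle_le) (simp add: norm_mult)
  also have "\<dots> \<le> cmod a * 1 + cmod b * 1"
    by (intro add_mono mult_left_mono) auto
  finally show ?thesis by (simp add: wave_def norm_mult norm_exp_i_times)
qed

lemma cmod_wave_1_0: "cmod (wave k \<alpha> 1 0 p) = \<bar>sin (pi * across \<alpha> p)\<bar>"
  by (simp add: wave_def norm_mult norm_exp_i_times)

lemma Laplacian_wave:
  "(\<Sum>v\<in>Basis. partial v (partial v (wave k \<alpha> 1 0)) p) = - complex_of_real (k\<^sup>2 + pi\<^sup>2) * wave k \<alpha> 1 0 p"
proof -
  have linear: "wave k \<alpha> a b p + wave k \<alpha> a' b' p = wave k \<alpha> (a + a') (b + b') p" for a b a' b'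
    by (simp add: wave_def algebra_simps)
  have trig: "complex_of_real (sin \<alpha>) * complex_of_real (sin \<alpha>)
      + complex_of_real (cos \<alpha>) * complex_of_real (cos \<alpha>) = 1"
    by (metis of_real_1 of_real_add of_real_mult power2_eq_square sin_cos_squared_add)
  have key: "- (x * (x * (c * c))) - (x * (x * (s * s)) + (y * (y * (c * c)) + y * (y * (s * s))))
      = - (x * x) - y * y" if "s * s + c * c = 1" for x y s c :: complex
    using that by algebra
  have "(\<Sum>v\<in>Basis. partial v (partial v (wave k \<alpha> 1 0)) p) = wave k \<alpha> (- (k * k + pi * pi)) 0 p"
    unfolding partial_wave
    by (simp add: Basis_plane linear across_def along_def algebra_simps key[OF trig])
  also have "\<dots> = - complex_of_real (k\<^sup>2 + pi\<^sup>2) * wave k \<alpha> 1 0 p"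
    by (simp add: wave_def power2_eq_square algebra_simps)
  finally show ?thesis .
qed

text \<open>
  The envelope of length \<open>n\<close> for \<open>p = q = 1\<close>; the other polynomials occur in its derivatives. It is a
  function of the horizontal coordinate instead of the coordinate along the branch: this keeps its
  support away from the left branch, where the rotated coordinates have no geometric meaning.
\<close>
definition envelope :: "real poly \<Rightarrow> real poly \<Rightarrow> real \<Rightarrow> real \<times> real \<Rightarrow> complex" where
  "envelope p q n v = complex_of_real (flat p (fst v / n - 1) * flat q (2 - fst v / n))"

lemma envelope_affine:
  "envelope p q n v = complex_of_real (flat p (inverse n * fst v + - 1))
    * complex_of_real (flat q (- inverse n * fst v + 2))"
  by (simp add: envelope_def divide_inverse mult.commute)

lemma smooth_envelope: "smooth (envelope p q n)"
  unfolding envelope_affine[abs_def]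
  by (intro smooth_mult smooth_flat_affine bounded_linear_const_mult bounded_linear_fst)

lemma partial_envelope:
  "partial b (envelope p q n) v =
    complex_of_real (fst b / n) * (envelope (flat_deriv p) q n v - envelope p (flat_deriv q) n v)"
proof -
  have l: "bounded_linear (\<lambda>v :: real \<times> real. inverse n * fst v)"
      "bounded_linear (\<lambda>v :: real \<times> real. - inverse n * fst v)"
    by (intro bounded_linear_const_mult bounded_linear_fst)+
  show ?thesis
    unfolding envelope_affine[abs_def]
    unfolding partial_mult[OF smooth_differentiable[OF smooth_flat_affine[OF l(1)]]
        smooth_differentiable[OF smooth_flat_affine[OF l(2)]]]
      partial_flat_affine[OF l(1)] partial_flat_affine[OF l(2)]
    by (simp add: divide_inverse algebra_simps)
qed

lemma partial_partial_envelope: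
  "partial b (partial b (envelope p q n)) v = complex_of_real ((fst b / n)\<^sup>2) *
    (envelope (flat_deriv (flat_deriv p)) q n v - 2 * envelope (flat_deriv p) (flat_deriv q) n v
      + envelope p (flat_deriv (flat_deriv q)) n v)"
proof -
  let ?c = "complex_of_real (fst b / n)"
  have eq: "partial b (envelope p q n) v
      = ?c * envelope (flat_deriv p) q n v + - ?c * envelope p (flat_deriv q) n v" for v
    by (simp add: partial_envelope algebra_simps)
  have cmult: "partial b (\<lambda>v. c * envelope p q n v) v = c * partial b (envelope p q n) v" for c p q
    by (rule partial_eq[OF has_derivative_mult_right[OF smooth_has_derivative[OF smooth_envelope]]])
  have d: "(\<lambda>v. c * envelope p q n v) differentiable (at v)" for c p q v
    by (intro smooth_differentiable smooth_mult smooth_const smooth_envelope)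
  show ?thesis
    unfolding eq unfolding partial_add[OF d d] cmult unfolding partial_envelope
    by (simp add: power2_eq_square algebra_simps)
qed

lemma envelope_nonzero:
  assumes "0 < n" "envelope p q n v \<noteq> 0"
  shows "n < fst v" "fst v < 2 * n"
proof -
  have "0 < fst v / n - 1" "0 < 2 - fst v / n"
    using assms(2) by (auto simp: envelope_def flat_def split: if_splits)
  then show "n < fst v" "fst v < 2 * n" using assms(1) by (auto simp: field_simps)
qed

lemma envelope_bounded: obtains K where "K > 0" "\<And>n v. cmod (envelope p q n v) \<le> K"
proof -
  obtain K where K: "K > 0" "\<And>y. \<bar>flat p y\<bar> \<le> K" by (rule flat_bounded[of p]) blast
  obtain L where L: "L > 0" "\<And>y. \<bar>flat q y\<bar> \<le> L" by (rule flat_bounded[of q]) blast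
  show ?thesis
  proof (rule that[of "K * L"])
    show "cmod (envelope p q n v) \<le> K * L" for n v
      unfolding envelope_def norm_of_real abs_mult using K L by (intro mult_mono) auto
  qed (use K L in simp)
qed

definition wave_packet :: "real \<Rightarrow> real \<Rightarrow> real \<Rightarrow> real \<times> real \<Rightarrow> complex" where
  "wave_packet k \<alpha> n p = envelope 1 1 n p * wave k \<alpha> 1 0 p"

lemma smooth_wave_packet: "smooth (wave_packet k \<alpha> n)"
  unfolding wave_packet_def[abs_def] by (intro smooth_mult smooth_envelope smooth_wave)

lemma partial_partial_mult:
  assumes f: "smooth f" and g: "smooth g" and b: "b \<in> Basis"
  shows "partial b (partial b (\<lambda>x. f x * g x)) x
    = f x * partial b (partial b g) x + 2 * (partial b f x * partial b g x) + partial b (partial b f) x * g x"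
proof -
  note d = smooth_differentiable[OF f] smooth_differentiable[OF g]
    smooth_differentiable[OF smooth_partial[OF f b]] smooth_differentiable[OF smooth_partial[OF g b]]
  have "partial b (\<lambda>x. f x * g x) = (\<lambda>x. f x * partial b g x + partial b f x * g x)"
    by (intro ext partial_mult d)
  moreover have "(\<lambda>x. f x * partial b g x) differentiable (at x)"
      "(\<lambda>x. partial b f x * g x) differentiable (at x)"
    by (intro smooth_differentiable smooth_mult smooth_partial f g b)+
  ultimately show ?thesis
    by (simp add: partial_add partial_mult d algebra_simps)
qed

lemma wave_packet_residual:
  "- (\<Sum>b\<in>Basis. partial b (partial b (wave_packet k \<alpha> n)) p)
      - complex_of_real (k\<^sup>2 + pi\<^sup>2) * wave_packet k \<alpha> n p
    = - (2 * (partial (1, 0) (envelope 1 1 n) p * partial (1, 0) (wave k \<alpha> 1 0) p)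
        + partial (1, 0) (partial (1, 0) (envelope 1 1 n)) p * wave k \<alpha> 1 0 p)"
proof -
  let ?B = "envelope 1 1 n" and ?E = "wave k \<alpha> 1 0"
  have "(\<Sum>b\<in>Basis. partial b (partial b (wave_packet k \<alpha> n)) p)
      = (\<Sum>b\<in>Basis. ?B p * partial b (partial b ?E) p + 2 * (partial b ?B p * partial b ?E p)
          + partial b (partial b ?B) p * ?E p)"
    unfolding wave_packet_def[abs_def]
    by (intro sum.cong refl partial_partial_mult smooth_envelope smooth_wave)
  also have "\<dots> = ?B p * (\<Sum>b\<in>Basis. partial b (partial b ?E) p)
      + (\<Sum>b\<in>Basis. 2 * (partial b ?B p * partial b ?E p) + partial b (partial b ?B) p * ?E p)"
    by (simp add: sum.distrib sum_distrib_left)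
  also have "\<dots> = - complex_of_real (k\<^sup>2 + pi\<^sup>2) * wave_packet k \<alpha> n p
      + (2 * (partial (1, 0) ?B p * partial (1, 0) ?E p) + partial (1, 0) (partial (1, 0) ?B) p * ?E p)"
    unfolding Laplacian_wave
    by (simp add: Basis_plane wave_packet_def partial_partial_envelope partial_envelope[where b = "(0, 1)"])
  finally show ?thesis by (simp add: algebra_simps)
qed

text \<open>The envelope varies on the scale \<open>n\<close>, so the packet solves the equation up to order \<open>1/n\<close>.\<close>
lemma wave_packet_residual_le:
  obtains M where "M > 0" "\<And>n p. 1 \<le> n \<Longrightarrow>
    cmod (- (\<Sum>b\<in>Basis. partial b (partial b (wave_packet k \<alpha> n)) p)
      - complex_of_real (k\<^sup>2 + pi\<^sup>2) * wave_packet k \<alpha> n p) \<le> M / n"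
proof -
  let ?d = flat_deriv
  obtain K1 where K1: "K1 > 0" "\<And>n v. cmod (envelope (?d 1) 1 n v) \<le> K1" by (rule envelope_bounded) blast
  obtain K2 where K2: "K2 > 0" "\<And>n v. cmod (envelope 1 (?d 1) n v) \<le> K2" by (rule envelope_bounded) blast
  obtain K3 where K3: "K3 > 0" "\<And>n v. cmod (envelope (?d (?d 1)) 1 n v) \<le> K3" by (rule envelope_bounded) blast
  obtain K4 where K4: "K4 > 0" "\<And>n v. cmod (envelope (?d 1) (?d 1) n v) \<le> K4" by (rule envelope_bounded) blast
  obtain K5 where K5: "K5 > 0" "\<And>n v. cmod (envelope 1 (?d (?d 1)) n v) \<le> K5" by (rule envelope_bounded) blast
  define M where "M = 2 * ((K1 + K2) * (\<bar>k\<bar> + pi)) + (K3 + 2 * K4 + K5)"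
  show ?thesis
  proof (rule that[of M])
    show "M > 0" using K1 K2 K3 K4 K5 by (simp add: M_def add_nonneg_pos)
    fix n :: real and p assume n: "1 \<le> n"
    let ?B = "envelope 1 1 n" and ?E = "wave k \<alpha> 1 0"
    let ?e = "(1, 0) :: real \<times> real"
    have B1: "cmod (partial ?e ?B p) \<le> (K1 + K2) / n"
    proof -
      have "cmod (envelope (?d 1) 1 n p - envelope 1 (?d 1) n p) \<le> K1 + K2"
        using norm_triangle_ineq4[of "envelope (?d 1) 1 n p" "envelope 1 (?d 1) n p"] K1(2)[of n p] K2(2)[of n p]
        by linarith
      then show ?thesis
        unfolding partial_envelope using n by (simp add: norm_mult norm_divide divide_right_mono)
    qed
    have B2: "cmod (partial ?e (partial ?e ?B) p) \<le> (K3 + 2 * K4 + K5) / n"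
    proof -
      have "cmod (envelope (?d (?d 1)) 1 n p - 2 * envelope (?d 1) (?d 1) n p + envelope 1 (?d (?d 1)) n p)
          \<le> cmod (envelope (?d (?d 1)) 1 n p) + cmod (2 * envelope (?d 1) (?d 1) n p)
            + cmod (envelope 1 (?d (?d 1)) n p)"
        using norm_triangle_ineq4[of "envelope (?d (?d 1)) 1 n p" "2 * envelope (?d 1) (?d 1) n p"]
        by (intro norm_triangle_le) simp
      also have "\<dots> \<le> K3 + 2 * K4 + K5"
        using K3(2)[of n p] K4(2)[of n p] K5(2)[of n p] by (simp add: norm_mult)
      finally have "cmod (partial ?e (partial ?e ?B) p) \<le> (1 / n)\<^sup>2 * (K3 + 2 * K4 + K5)"
        unfolding partial_partial_envelope using n
        by (simp add: norm_mult norm_divide norm_power mult_left_mono)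
      also have "\<dots> \<le> (1 / n) * (K3 + 2 * K4 + K5)"
        using n K3 K4 K5 by (intro mult_right_mono) (auto simp: power2_eq_square field_simps)
      finally show ?thesis by simp
    qed
    have E0: "cmod (?E p) \<le> 1" using cmod_wave_le[of k \<alpha> 1 0 p] by simp
    have E1: "cmod (partial ?e ?E p) \<le> \<bar>k\<bar> + pi"
    proof -
      have "cmod (partial ?e ?E p) \<le> \<bar>k\<bar> * \<bar>along \<alpha> ?e\<bar> + pi * \<bar>across \<alpha> ?e\<bar>"
        unfolding partial_wave using cmod_wave_le[of k \<alpha> "\<i> * k * along \<alpha> ?e" "pi * across \<alpha> ?e" p]
        by (simp add: norm_mult abs_mult)
      also have "\<dots> \<le> \<bar>k\<bar> * 1 + pi * 1"
        by (intro add_mono mult_left_mono along_Basis_le across_Basis_le) (auto simp: Basis_plane)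
      finally show ?thesis by simp
    qed
    have "cmod (2 * (partial ?e ?B p * partial ?e ?E p) + partial ?e (partial ?e ?B) p * ?E p)
        \<le> 2 * (cmod (partial ?e ?B p) * cmod (partial ?e ?E p)) + cmod (partial ?e (partial ?e ?B) p) * cmod (?E p)"
      using norm_triangle_ineq[of "2 * (partial ?e ?B p * partial ?e ?E p)" "partial ?e (partial ?e ?B) p * ?E p"]
      by (simp add: norm_mult)
    also have "\<dots> \<le> 2 * ((K1 + K2) / n * (\<bar>k\<bar> + pi)) + (K3 + 2 * K4 + K5) / n * 1"
      using n K1 K2 K3 K4 K5 by (intro add_mono mult_left_mono mult_mono B1 B2 E0 E1) auto
    also have "\<dots> = M / n" by (simp add: M_def add_divide_distrib algebra_simps)
    finally show "cmod (- (\<Sum>b\<in>Basis. partial b (partial b (wave_packet k \<alpha> n)) p)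
        - complex_of_real (k\<^sup>2 + pi\<^sup>2) * wave_packet k \<alpha> n p) \<le> M / n"
      unfolding wave_packet_residual norm_minus_cancel .
  qed
qed

section \<open>Wave packets lie in the domain of the Dirichlet Laplacian\<close>

definition strip :: "real \<Rightarrow> real \<Rightarrow> (real \<times> real) set" where
  "strip \<alpha> n = {p. n \<le> fst p \<and> fst p \<le> 2 * n \<and> 0 \<le> across \<alpha> p \<and> across \<alpha> p \<le> 1}"

lemma bounded_strip:
  assumes "0 < sin \<alpha>"
  shows "bounded (strip \<alpha> n)"
proof -
  let ?B = "(1 + 2 * \<bar>n\<bar>) / sin \<alpha>"
  have "strip \<alpha> n \<subseteq> {n..2 * n} \<times> {- ?B..?B}"
  proof
    fix p assume p: "p \<in> strip \<alpha> n"
    then have x: "n \<le> fst p" "fst p \<le> 2 * n" and t: "0 \<le> across \<alpha> p" "across \<alpha> p \<le> 1"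
      by (auto simp: strip_def)
    have "\<bar>fst p * cos \<alpha>\<bar> \<le> (2 * \<bar>n\<bar>) * 1"
      unfolding abs_mult using x by (intro mult_mono) auto
    moreover have "snd p * sin \<alpha> = across \<alpha> p + fst p * cos \<alpha>" by (simp add: across_def)
    ultimately have "\<bar>snd p * sin \<alpha>\<bar> \<le> 1 + 2 * \<bar>n\<bar>" using t by linarith
    then have "\<bar>snd p\<bar> \<le> ?B" using assms by (simp add: abs_mult pos_le_divide_eq)
    then show "p \<in> {n..2 * n} \<times> {- ?B..?B}"
      using x by (cases p) (auto simp: abs_le_iff)
  qed
  moreover have "bounded ({n..2 * n} \<times> {- ?B..?B})"
    by (intro bounded_Times bounded_closed_interval)
  ultimately show ?thesis by (rule bounded_subset[rotated])
qed

lemma continuous_on_across: "continuous_on S (across \<alpha>)"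
  by (rule linear_continuous_on[OF bounded_linear_across])

lemma V_waveguide_slab_subset_strip:
  assumes "0 < n" "p \<in> V_waveguide \<alpha>" "n \<le> fst p" "fst p \<le> 2 * n"
  shows "p \<in> strip \<alpha> n"
  using assms V_waveguide_right_branch[of p \<alpha>] by (simp add: strip_def)

lemma L2_slab:
  assumes \<alpha>: "0 < sin \<alpha>" and n: "0 < n" and f: "smooth f"
    and supp: "\<And>p. f p \<noteq> 0 \<Longrightarrow> n \<le> fst p \<and> fst p \<le> 2 * n"
  shows "f \<in> L2 (V_waveguide \<alpha>)"
proof (rule L2_continuous_bounded_support[OF open_V_waveguide smooth_continuous[OF f]])
  show "bounded {p\<in>V_waveguide \<alpha>. f p \<noteq> 0}"
    by (rule bounded_subset[OF bounded_strip[OF \<alpha>, of n]])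
       (use supp V_waveguide_slab_subset_strip[OF n] in blast)
qed

lemma partial_slab:
  fixes f :: "real \<times> real \<Rightarrow> complex"
  assumes "\<And>p. f p \<noteq> 0 \<Longrightarrow> n \<le> fst p \<and> fst p \<le> 2 * n" "partial b f p \<noteq> 0"
  shows "n \<le> fst p \<and> fst p \<le> 2 * n"
proof -
  have "closed {p :: real \<times> real. n \<le> fst p \<and> fst p \<le> 2 * n}"
    by (intro closed_Collect_conj closed_Collect_le continuous_intros)
  then have "closure {p. f p \<noteq> 0} \<subseteq> {p. n \<le> fst p \<and> fst p \<le> 2 * n}"
    using assms(1) by (intro closure_minimal) auto
  then show ?thesis using partial_support[where f = f and b = b] assms(2) by blast
qed

lemma wave_packet_slab:
  "0 < n \<Longrightarrow> wave_packet k \<alpha> n p \<noteq> 0 \<Longrightarrow> n \<le> fst p \<and> fst p \<le> 2 * n"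
  using envelope_nonzero[of n 1 1 p] by (auto simp: wave_packet_def)

lemma wave_packet_L2:
  assumes "0 < sin \<alpha>" "0 < n"
  shows "wave_packet k \<alpha> n \<in> L2 (V_waveguide \<alpha>)"
    and "b \<in> Basis \<Longrightarrow> partial b (wave_packet k \<alpha> n) \<in> L2 (V_waveguide \<alpha>)"
    and "b \<in> Basis \<Longrightarrow> partial b (partial b (wave_packet k \<alpha> n)) \<in> L2 (V_waveguide \<alpha>)"
proof -
  note s0 = smooth_wave_packet[of k \<alpha> n]
  note p0 = wave_packet_slab[OF assms(2), of k \<alpha>]
  note p1 = partial_slab[OF p0]
  note p2 = partial_slab[OF p1]
  show "wave_packet k \<alpha> n \<in> L2 (V_waveguide \<alpha>)" by (rule L2_slab[OF assms s0 p0])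
  show "partial b (wave_packet k \<alpha> n) \<in> L2 (V_waveguide \<alpha>)" if b: "b \<in> Basis"
    by (rule L2_slab[OF assms smooth_partial[OF s0 b] p1])
  show "partial b (partial b (wave_packet k \<alpha> n)) \<in> L2 (V_waveguide \<alpha>)" if b: "b \<in> Basis"
    by (rule L2_slab[OF assms smooth_partial[OF smooth_partial[OF s0 b] b] p2])
qed

definition cutoff_deriv :: "real \<Rightarrow> real \<Rightarrow> nat \<Rightarrow> real \<Rightarrow> real" where
  "cutoff_deriv a b j t = real j *
    (flat (flat_deriv 1) (j * (t - a) - 1) * flat 1 (j * (b - t) - 1)
      - flat 1 (j * (t - a) - 1) * flat (flat_deriv 1) (j * (b - t) - 1))"

lemma cutoff_has_derivative: "(cutoff a b j has_real_derivative cutoff_deriv a b j t) (at t)"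
proof -
  have 1: "((\<lambda>t. real j * (t - a) - 1) has_real_derivative real j) (at t)"
    by (auto intro!: derivative_eq_intros)
  have 2: "((\<lambda>t. real j * (b - t) - 1) has_real_derivative - real j) (at t)"
    by (auto intro!: derivative_eq_intros)
  note D = DERIV_mult[OF DERIV_chain2[OF flat_has_derivative[of 1] 1] DERIV_chain2[OF flat_has_derivative[of 1] 2]]
  show ?thesis
    unfolding cutoff_def[abs_def]
    by (rule DERIV_cong[OF D]) (simp add: cutoff_deriv_def algebra_simps)
qed

lemma flat_deriv_1: "(y + 1) * flat (flat_deriv 1) y = flat [:0, 1, 1:] y"
  by (simp add: flat_def flat_deriv_def field_simps)

lemma flat_deriv_1_nonneg: "0 \<le> flat (flat_deriv 1) y"
  by (simp add: flat_def flat_deriv_def)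

text \<open>
  The cutoff has slope \<open>j\<close> only at distance \<open>1/j\<close> from the ends, where the sine is of size \<open>1/j\<close>.
\<close>
lemma sin_cutoff_deriv_le:
  assumes t: "0 < t" "t < 1"
  shows "\<bar>sin (pi * t)\<bar> * \<bar>cutoff_deriv 0 1 j t\<bar>
    \<le> pi * (flat [:0, 1, 1:] (j * t - 1) + flat [:0, 1, 1:] (j * (1 - t) - 1))"
proof -
  define a where "a = flat (flat_deriv 1) (j * t - 1)"
  define b where "b = flat (flat_deriv 1) (j * (1 - t) - 1)"
  have ab: "0 \<le> a" "0 \<le> b" by (simp_all add: a_def b_def flat_deriv_1_nonneg)
  have a: "j * t * a = flat [:0, 1, 1:] (j * t - 1)"
    using flat_deriv_1[of "j * t - 1"] by (simp add: a_def)
  have b: "j * (1 - t) * b = flat [:0, 1, 1:] (j * (1 - t) - 1)"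
    using flat_deriv_1[of "j * (1 - t) - 1"] by (simp add: b_def)
  have pos: "0 \<le> sin (pi * t)" using t by (intro sin_ge_zero) auto
  have s1: "sin (pi * t) \<le> pi * t" using t by (intro sin_x_le_x) simp
  have "sin (pi * t) = sin (pi * (1 - t))"
    using sin_pi_minus[of "pi * t"] by (simp add: algebra_simps)
  also have "\<dots> \<le> pi * (1 - t)" using t by (intro sin_x_le_x) simp
  finally have s2: "sin (pi * t) \<le> pi * (1 - t)" .
  have "\<bar>a * flat 1 (j * (1 - t) - 1) - flat 1 (j * t - 1) * b\<bar>
      \<le> a * flat 1 (j * (1 - t) - 1) + flat 1 (j * t - 1) * b"
    using ab mult_nonneg_nonneg[OF ab(1) flat_1_bounds(1)] mult_nonneg_nonneg[OF flat_1_bounds(1) ab(2)]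
    by (simp add: abs_le_iff)
  also have "\<dots> \<le> a * 1 + 1 * b"
    using ab by (intro add_mono mult_left_mono mult_right_mono flat_1_bounds)
  finally have "\<bar>cutoff_deriv 0 1 j t\<bar> \<le> j * (a + b)"
    by (simp add: cutoff_deriv_def abs_mult a_def b_def mult_left_mono)
  then have "\<bar>sin (pi * t)\<bar> * \<bar>cutoff_deriv 0 1 j t\<bar> \<le> sin (pi * t) * (j * (a + b))"
    using pos by (simp add: mult_left_mono)
  also have "\<dots> = sin (pi * t) * (j * a) + sin (pi * t) * (j * b)"
    by (simp add: algebra_simps)
  also have "\<dots> \<le> (pi * t) * (j * a) + (pi * (1 - t)) * (j * b)"
    using ab by (intro add_mono mult_right_mono s1 s2) auto
  also have "\<dots> = pi * (j * t * a + j * (1 - t) * b)" by (simp add: algebra_simps)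
  finally show ?thesis unfolding a b .
qed

text \<open>
  The approximants are the products with cutoffs across the strip. Their derivatives converge
  pointwise and stay bounded, and everything lives on a bounded set.
\<close>
lemma wave_packet_H01:
  assumes \<alpha>: "0 < sin \<alpha>" and n: "0 < n"
  shows "wave_packet k \<alpha> n \<in> H01 (V_waveguide \<alpha>)"
proof -
  let ?\<Omega> = "V_waveguide \<alpha>"
  define u where "u = wave_packet k \<alpha> n"
  \<comment> \<open>the shift by one avoids the index \<open>0\<close>, for which \<open>1/m\<close> is zero\<close>
  define \<kappa> where "\<kappa> m p = complex_of_real (cutoff 0 1 (Suc m) (across \<alpha> p))" for m p
  have u: "smooth u" by (simp add: u_def smooth_wave_packet)
  have \<kappa>: "smooth (\<kappa> m)" for m
    unfolding \<kappa>_def by (rule smooth_cutoff[OF bounded_linear_across])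
  note slab = wave_packet_slab[OF n, of k \<alpha>, folded u_def]
  have off: "u p = 0" "partial b u p = 0" if "p \<in> ?\<Omega>" "p \<notin> strip \<alpha> n" for p b
    using V_waveguide_slab_subset_strip[OF n that(1)] slab[of p] partial_slab[OF slab, where p = p and b = b] that(2)
    by blast+
  have d\<kappa>: "partial b (\<kappa> m) p = complex_of_real (across \<alpha> b * cutoff_deriv 0 1 (Suc m) (across \<alpha> p))" for b m p
  proof -
    have "(across \<alpha> has_derivative across \<alpha>) (at p)"
      by (rule bounded_linear_imp_has_derivative[OF bounded_linear_across])
    from has_derivative_of_real[OF has_derivative_compose[OF this
          cutoff_has_derivative[unfolded has_field_derivative_def]]]
    have "(\<kappa> m has_derivative (\<lambda>b. complex_of_real (cutoff_deriv 0 1 (Suc m) (across \<alpha> p) * across \<alpha> b))) (at p)"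
      unfolding \<kappa>_def .
    from partial_eq[OF this] show ?thesis by (simp add: mult.commute)
  qed
  have part: "partial b (\<lambda>p. u p * \<kappa> m p) p = u p * partial b (\<kappa> m) p + partial b u p * \<kappa> m p" for b m p
    by (intro partial_mult smooth_differentiable u \<kappa>)
  have test: "(\<lambda>p. u p * \<kappa> m p) \<in> test_functions ?\<Omega>" for m
  proof (rule test_functionsI)
    let ?K = "{p. n \<le> fst p \<and> fst p \<le> 2 * n \<and> 1 / Suc m \<le> across \<alpha> p \<and> across \<alpha> p \<le> 1 - 1 / Suc m}"
    have K: "n \<le> fst p" "fst p \<le> 2 * n" "0 < across \<alpha> p" "across \<alpha> p < 1" if "p \<in> ?K" for p
    proof -
      have pos: "0 < 1 / real (Suc m)" by simp
      have p: "n \<le> fst p \<and> fst p \<le> 2 * n \<and> 1 / Suc m \<le> across \<alpha> p \<and> across \<alpha> p \<le> 1 - 1 / Suc m"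
        using that by (rule CollectD)
      then show "n \<le> fst p" "fst p \<le> 2 * n" by blast+
      from p pos show "0 < across \<alpha> p" "across \<alpha> p < 1" by linarith+
    qed
    show "smooth (\<lambda>p. u p * \<kappa> m p)" by (rule smooth_mult[OF u \<kappa>])
    have "closed ?K"
      by (intro closed_Collect_conj closed_Collect_le continuous_intros continuous_on_across)
    moreover have "?K \<subseteq> strip \<alpha> n" 
    proof
      fix p assume "p \<in> ?K"
      from K[OF this] show "p \<in> strip \<alpha> n" by (simp add: strip_def)
    qed
    ultimately show "compact ?K"
      using bounded_subset[OF bounded_strip[OF \<alpha>]] by (simp add: compact_eq_bounded_closed)
    show "?K \<subseteq> ?\<Omega>"
    proof
      fix p assume "p \<in> ?K"
      from K[OF this] n show "p \<in> ?\<Omega>" by (subst V_waveguide_right_branch) auto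
    qed
    show "p \<in> ?K" if "u p * \<kappa> m p \<noteq> 0" for p
    proof -
      have "cutoff 0 1 (Suc m) (across \<alpha> p) \<noteq> 0" using that by (auto simp: \<kappa>_def)
      from cutoff_nonzero[OF this] slab[of p] that show ?thesis by auto
    qed
  qed
  obtain Ku where Ku: "Ku > 0" "\<And>p. p \<in> strip \<alpha> n \<Longrightarrow> cmod (u p) \<le> Ku"
    using continuous_bounded_support_bounded[OF smooth_continuous[OF u] bounded_strip[OF \<alpha>]] by blast
  have le_u: "cmod (u p) \<le> Ku" if "p \<in> ?\<Omega>" for p
    using Ku off(1)[OF that] by (cases "p \<in> strip \<alpha> n") auto
  have le_\<kappa>: "cmod (1 - \<kappa> m p) \<le> 1" for m p
  proof -
    have "1 - \<kappa> m p = complex_of_real (1 - cutoff 0 1 (Suc m) (across \<alpha> p))"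
      by (simp add: \<kappa>_def)
    then show ?thesis using cutoff_bounds[of 0 1 "Suc m" "across \<alpha> p"] by (simp only: norm_of_real)
  qed
  have across: "0 < across \<alpha> p" "across \<alpha> p < 1" if "p \<in> ?\<Omega>" "p \<in> strip \<alpha> n" for p
    using that n V_waveguide_right_branch[of p \<alpha>] by (auto simp: strip_def)
  have lim_\<kappa>: "(\<lambda>m. 1 - \<kappa> m p) \<longlonglongrightarrow> 0" if "p \<in> ?\<Omega>" "p \<in> strip \<alpha> n" for p
  proof -
    have "(\<lambda>m. cutoff 0 1 (Suc m) (across \<alpha> p)) \<longlonglongrightarrow> 1"
      using LIMSEQ_Suc[OF cutoff_tendsto[of 0 1 "across \<alpha> p"]] across[OF that] by simp
    then have "(\<lambda>m. complex_of_real (1 - cutoff 0 1 (Suc m) (across \<alpha> p))) \<longlonglongrightarrow> complex_of_real (1 - 1)"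
      by (intro tendsto_of_real tendsto_diff tendsto_const)
    then show ?thesis by (simp add: \<kappa>_def)
  qed
  have L2: "(\<lambda>m. L2_norm ?\<Omega> (\<lambda>p. u p - u p * \<kappa> m p)) \<longlonglongrightarrow> 0"
  proof (rule L2_norm_tendsto_0[OF open_V_waveguide _ bounded_strip[OF \<alpha>, of n], where K = Ku])
    have eq: "u p - u p * \<kappa> m p = u p * (1 - \<kappa> m p)" for m p by (simp add: algebra_simps)
    show "continuous_on UNIV (\<lambda>p. u p - u p * \<kappa> m p)" for m
      by (intro continuous_intros smooth_continuous u \<kappa>)
    show "u p - u p * \<kappa> m p = 0" if "p \<in> ?\<Omega>" "p \<notin> strip \<alpha> n" for m p
      using off(1)[OF that] by simp
    show "cmod (u p - u p * \<kappa> m p) \<le> Ku" if "p \<in> ?\<Omega>" for m p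
      unfolding eq norm_mult using mult_mono[OF le_u[OF that] le_\<kappa>[of m p]] Ku(1) by simp
    show "(\<lambda>m. u p - u p * \<kappa> m p) \<longlonglongrightarrow> 0" if "p \<in> ?\<Omega>" for p
      unfolding eq using tendsto_mult_right_zero[OF lim_\<kappa>[OF that]] off(1)[OF that]
      by (cases "p \<in> strip \<alpha> n") auto
  qed
  obtain Ke where Ke: "Ke > 0" "\<And>n v. cmod (envelope 1 1 n v) \<le> Ke"
    by (rule envelope_bounded) blast
  obtain Kq where Kq: "Kq > 0" "\<And>y. \<bar>flat [:0, 1, 1:] y\<bar> \<le> Kq"
    by (rule flat_bounded) blast
  \<comment> \<open>bounds the product of the sine with the derivative of the cutoff, up to the factor \<open>pi\<close>\<close>
  define \<rho> where "\<rho> m p = flat [:0, 1, 1:] (real (Suc m) * across \<alpha> p - 1)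
      + flat [:0, 1, 1:] (real (Suc m) * (1 - across \<alpha> p) - 1)" for m p
  have le_d\<kappa>: "cmod (u p * partial b (\<kappa> m) p) \<le> Ke * (pi * \<rho> m p)"
    if "p \<in> ?\<Omega>" "p \<in> strip \<alpha> n" "b \<in> Basis" for b m p
  proof -
    have "cmod (u p * partial b (\<kappa> m) p) = cmod (envelope 1 1 n p) *
        (\<bar>across \<alpha> b\<bar> * (\<bar>sin (pi * across \<alpha> p)\<bar> * \<bar>cutoff_deriv 0 1 (Suc m) (across \<alpha> p)\<bar>))"
      unfolding d\<kappa> u_def wave_packet_def norm_mult cmod_wave_1_0 norm_of_real abs_mult by simp
    also have "\<dots> \<le> Ke * (1 * (pi * \<rho> m p))"
      unfolding \<rho>_def using Ke(1)
      by (intro mult_mono Ke(2) across_Basis_le that sin_cutoff_deriv_le across[OF that(1,2)]) auto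
    finally show ?thesis by simp
  qed
  have L2': "(\<lambda>m. L2_norm ?\<Omega> (\<lambda>p. partial b u p - partial b (\<lambda>p. u p * \<kappa> m p) p)) \<longlonglongrightarrow> 0"
    if b: "b \<in> Basis" for b
  proof -
    note u' = smooth_partial[OF u b]
    obtain K' where K': "K' > 0" "\<And>p. p \<in> strip \<alpha> n \<Longrightarrow> cmod (partial b u p) \<le> K'"
      using continuous_bounded_support_bounded[OF smooth_continuous[OF u'] bounded_strip[OF \<alpha>]] by blast
    have eq: "partial b u p - partial b (\<lambda>p. u p * \<kappa> m p) p
        = partial b u p * (1 - \<kappa> m p) - u p * partial b (\<kappa> m) p" for m p
      by (simp add: part algebra_simps)
    show ?thesis
      unfolding eq
    proof (rule L2_norm_tendsto_0[OF open_V_waveguide _ bounded_strip[OF \<alpha>, of n],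
          where K = "K' + Ke * (pi * (Kq + Kq))"])
      show "continuous_on UNIV (\<lambda>p. partial b u p * (1 - \<kappa> m p) - u p * partial b (\<kappa> m) p)" for m
        by (intro continuous_intros smooth_continuous[OF u] smooth_continuous[OF \<kappa>]
            smooth_continuous[OF u'] smooth_continuous[OF smooth_partial[OF \<kappa> b]])
      show "partial b u p * (1 - \<kappa> m p) - u p * partial b (\<kappa> m) p = 0"
        if "p \<in> ?\<Omega>" "p \<notin> strip \<alpha> n" for m p
        using off[OF that] by simp
      show "cmod (partial b u p * (1 - \<kappa> m p) - u p * partial b (\<kappa> m) p) \<le> K' + Ke * (pi * (Kq + Kq))"
        if p: "p \<in> ?\<Omega>" for m p
      proof (cases "p \<in> strip \<alpha> n")
        case True
        have "\<rho> m p \<le> Kq + Kq"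
          unfolding \<rho>_def using Kq(2) by (intro add_mono) (simp_all add: abs_le_iff)
        then have "Ke * (pi * \<rho> m p) \<le> Ke * (pi * (Kq + Kq))"
          using Ke(1) by (intro mult_left_mono) auto
        with le_d\<kappa>[OF p True b, of m] have "cmod (u p * partial b (\<kappa> m) p) \<le> Ke * (pi * (Kq + Kq))"
          by linarith
        moreover have "cmod (partial b u p * (1 - \<kappa> m p)) \<le> K' * 1"
          unfolding norm_mult using K'(1) by (intro mult_mono K'(2)[OF True] le_\<kappa>) auto
        ultimately show ?thesis
          using norm_triangle_ineq4[of "partial b u p * (1 - \<kappa> m p)" "u p * partial b (\<kappa> m) p"]
          by linarith
      next
        case False
        then show ?thesis using off[OF p False] K'(1) Ke(1) Kq(1) by simp
      qed
      show "(\<lambda>m. partial b u p * (1 - \<kappa> m p) - u p * partial b (\<kappa> m) p) \<longlonglongrightarrow> 0" if p: "p \<in> ?\<Omega>" for p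
      proof (cases "p \<in> strip \<alpha> n")
        case True
        have "(\<lambda>m. \<rho> m p) \<longlonglongrightarrow> poly [:0, 1, 1:] 0 + poly [:0, 1, 1:] 0"
          unfolding \<rho>_def using across[OF p True]
          by (intro tendsto_add LIMSEQ_Suc[OF flat_dilation_tendsto]) auto
        then have "(\<lambda>m. Ke * (pi * \<rho> m p)) \<longlonglongrightarrow> 0"
          by (intro tendsto_mult_right_zero) simp
        then have "(\<lambda>m. u p * partial b (\<kappa> m) p) \<longlonglongrightarrow> 0"
          by (rule Lim_null_comparison[rotated]) (intro always_eventually allI le_d\<kappa>[OF p True b])
        from tendsto_diff[OF tendsto_mult_right_zero[OF lim_\<kappa>[OF p True]] this]
        show ?thesis by simp
      next
        case False
        then show ?thesis using off[OF p False] by simp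
      qed
    qed
  qed
  have "u \<in> H01 ?\<Omega>"
    by (rule smooth_H01[OF open_V_waveguide u _ _ test L2 L2'])
       (simp_all add: u_def wave_packet_L2[OF \<alpha> n])
  then show ?thesis by (simp add: u_def)
qed

lemma wave_packet_Dirichlet_Laplacian:
  assumes "0 < sin \<alpha>" "0 < n"
  shows "(wave_packet k \<alpha> n, \<lambda>p. - (\<Sum>b\<in>Basis. partial b (partial b (wave_packet k \<alpha> n)) p))
    \<in> Dirichlet_Laplacian (V_waveguide \<alpha>)"
  by (rule smooth_Dirichlet_Laplacian[OF open_V_waveguide smooth_wave_packet wave_packet_H01[OF assms]
        wave_packet_L2(2,3)[OF assms]])

section \<open>The half-line above the threshold lies in the spectrum\<close>

text \<open>
  The mass near the centre of the packet, in a ball whose radius does not depend on \<open>n\<close>, suffices as a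
  lower bound, because the residual tends to zero.
\<close>
lemma wave_packet_norm_ge:
  assumes \<alpha>: "0 < sin \<alpha>"
  obtains c where "c > 0" "\<And>n. 1 \<le> n \<Longrightarrow> c \<le> (L2_norm (V_waveguide \<alpha>) (wave_packet k \<alpha> n))\<^sup>2"
proof -
  let ?\<Omega> = "V_waveguide \<alpha>"
  define r where "r = exp (- 4) * exp (- 4) * (1 / 2 :: real)"
  define c where "c = r\<^sup>2 * measure lborel (ball (0 :: real \<times> real) (1 / 8))"
  show ?thesis
  proof (rule that[of c])
    show "c > 0" by (simp add: c_def r_def content_ball_pos)
    fix n :: real assume n: "1 \<le> n"
    \<comment> \<open>the point of the centre line of the branch in the middle of the envelope\<close>
    define p0 where "p0 = (3 / 2 * n, (1 / 2 + 3 / 2 * n * cos \<alpha>) / sin \<alpha>)"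
    have p0: "across \<alpha> p0 = 1 / 2" using \<alpha> by (simp add: p0_def across_def)
    have "p \<in> ?\<Omega> \<and> r \<le> cmod (wave_packet k \<alpha> n p)" if p: "p \<in> ball p0 (1 / 8)" for p
    proof -
      have d: "norm (p - p0) < 1 / 8" using p by (simp add: dist_norm norm_minus_commute)
      then have d': "norm (fst (p - p0), snd (p - p0)) < 1 / 8" by (simp only: prod.collapse)
      have "\<bar>fst (p - p0)\<bar> < 1 / 8" "\<bar>snd (p - p0)\<bar> < 1 / 8"
        using order.strict_trans1[OF norm_fst_le d'] order.strict_trans1[OF norm_snd_le d']
        unfolding real_norm_def .
      then have dx: "\<bar>fst p - 3 / 2 * n\<bar> < 1 / 8" and dz: "\<bar>snd p - snd p0\<bar> < 1 / 8"
        by (simp_all add: p0_def)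
      have "across \<alpha> p - 1 / 2 = (snd p - snd p0) * sin \<alpha> - (fst p - fst p0) * cos \<alpha>"
        unfolding p0[symmetric] by (simp add: across_def algebra_simps)
      moreover have "\<bar>(snd p - snd p0) * sin \<alpha>\<bar> \<le> 1 / 8 * 1" "\<bar>(fst p - fst p0) * cos \<alpha>\<bar> \<le> 1 / 8 * 1"
        unfolding abs_mult using dx dz by (intro mult_mono; simp add: p0_def)+
      ultimately have t: "\<bar>across \<alpha> p - 1 / 2\<bar> \<le> 1 / 4" by linarith
      have "fst p > 0" using dx n by linarith
      moreover have "0 < across \<alpha> p" "across \<alpha> p < 1" using t by linarith+
      ultimately have "p \<in> ?\<Omega>" by (simp add: V_waveguide_right_branch)
      have "cos (pi / 3) \<le> cos \<bar>pi * (across \<alpha> p - 1 / 2)\<bar>"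
      proof (rule cos_monotone_0_pi_le)
        have "pi * \<bar>across \<alpha> p - 1 / 2\<bar> \<le> pi * (1 / 3)"
          using t by (intro mult_left_mono) auto
        then show "\<bar>pi * (across \<alpha> p - 1 / 2)\<bar> \<le> pi / 3" by (simp add: abs_mult)
      qed auto
      also have "\<dots> = sin (pi * across \<alpha> p)"
        unfolding cos_abs_real by (simp add: cos_diff right_diff_distrib)
      finally have s: "1 / 2 \<le> sin (pi * across \<alpha> p)" by (simp add: cos_60)
      have flat: "exp (- 4) \<le> flat 1 y" if "1 / 4 \<le> y" for y
      proof -
        have "1 / y \<le> 4" using that by (simp add: field_simps)
        then show ?thesis using that by (simp add: flat_def)
      qed
      have "11 / 8 * n \<le> fst p" "fst p \<le> 13 / 8 * n" using dx n by linarith+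
      then have "1 / 4 \<le> fst p / n - 1" "1 / 4 \<le> 2 - fst p / n" using n by (simp_all add: field_simps)
      then have fl: "exp (- 4) * exp (- 4) \<le> flat 1 (fst p / n - 1) * flat 1 (2 - fst p / n)"
        by (intro mult_mono flat) (auto simp: flat_1_bounds)
      have "r \<le> (flat 1 (fst p / n - 1) * flat 1 (2 - fst p / n)) * \<bar>sin (pi * across \<alpha> p)\<bar>"
        unfolding r_def using s by (intro mult_mono[OF fl]) (auto simp: flat_1_bounds)
      also have "\<dots> = cmod (wave_packet k \<alpha> n p)"
        by (simp add: wave_packet_def norm_mult cmod_wave_1_0 envelope_def flat_1_bounds)
      finally show ?thesis using \<open>p \<in> ?\<Omega>\<close> by simp
    qed
    note ball = this
    have meas: "(\<lambda>p. (cmod (wave_packet k \<alpha> n p))\<^sup>2) \<in> borel_measurable borel"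
      by (intro borel_measurable_continuous_onI continuous_intros smooth_continuous smooth_wave_packet)
    have "c = (\<integral>p. r\<^sup>2 * indicator (ball p0 (1 / 8)) p \<partial>lborel)"
      by (simp add: c_def content_ball)
    also have "\<dots> \<le> (\<integral>p. indicator ?\<Omega> p *\<^sub>R (cmod (wave_packet k \<alpha> n p))\<^sup>2 \<partial>lborel)"
    proof (rule integral_mono)
      show "integrable lborel (\<lambda>p. r\<^sup>2 * indicator (ball p0 (1 / 8)) p)"
        using emeasure_bounded_finite[OF bounded_ball[of p0 "1 / 8"]]
        by (intro integrable_mult_right integrable_real_indicator) simp_all
      show "integrable lborel (\<lambda>p. indicator ?\<Omega> p *\<^sub>R (cmod (wave_packet k \<alpha> n p))\<^sup>2)"
        using L2_integrable[OF wave_packet_L2(1)[OF \<alpha>, of n k]] n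
        by (simp add: integral_lebesgue_on_eq_lborel(2)[OF open_V_waveguide meas])
      show "r\<^sup>2 * indicator (ball p0 (1 / 8)) p \<le> indicator ?\<Omega> p *\<^sub>R (cmod (wave_packet k \<alpha> n p))\<^sup>2" for p
      proof (cases "p \<in> ball p0 (1 / 8)")
        case True
        have "r\<^sup>2 \<le> (cmod (wave_packet k \<alpha> n p))\<^sup>2"
          using ball[OF True] by (intro power_mono) (auto simp: r_def)
        then show ?thesis using ball[OF True] True by simp
      qed simp
    qed
    also have "\<dots> = (L2_norm ?\<Omega> (wave_packet k \<alpha> n))\<^sup>2"
      by (simp add: L2_norm_square integral_lebesgue_on_eq_lborel(1)[OF open_V_waveguide meas])
    finally show "c \<le> (L2_norm ?\<Omega> (wave_packet k \<alpha> n))\<^sup>2" .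
  qed
qed

lemma integral_slab:
  assumes \<alpha>: "0 < sin \<alpha>" and n: "0 < n"
  defines "S \<equiv> {p. n \<le> fst p \<and> fst p \<le> 2 * n \<and> 0 < across \<alpha> p \<and> across \<alpha> p < 1}"
  shows "integrable lborel (indicator S :: _ \<Rightarrow> real)" "(\<integral>p. indicator S p \<partial>lborel) = n / sin \<alpha>"
proof -
  have "S = {p. n \<le> fst p} \<inter> {p. fst p \<le> 2 * n} \<inter> ({p. 0 < across \<alpha> p} \<inter> {p. across \<alpha> p < 1})"
    by (auto simp: S_def)
  also have "\<dots> \<in> sets borel"
    by (intro sets.Int borel_closed borel_open closed_Collect_le open_Collect_less
        continuous_intros continuous_on_across)
  finally have S: "S \<in> sets borel" .
  show int: "integrable lborel (indicator S :: _ \<Rightarrow> real)"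
  proof (rule integrable_bounded_support[where K = 1])
    show "bounded {p. (indicator S p :: real) \<noteq> 0}"
      by (rule bounded_subset[OF bounded_strip[OF \<alpha>, of n]])
         (auto simp: S_def strip_def indicator_def split: if_splits)
  qed (use S in \<open>auto simp: indicator_def\<close>)
  have inner: "(\<integral>z. indicator S (x, z) \<partial>lborel) = indicator {n..2 * n} x * (1 / sin \<alpha>)" for x
  proof -
    define a where "a = x * cos \<alpha> / sin \<alpha>"
    have "0 < across \<alpha> (x, z) \<and> across \<alpha> (x, z) < 1 \<longleftrightarrow> z \<in> {a <..< a + 1 / sin \<alpha>}" for z
    proof -
      have "a + 1 / sin \<alpha> = (x * cos \<alpha> + 1) / sin \<alpha>" by (simp add: a_def add_divide_distrib)
      then show ?thesis
        using \<alpha> by (auto simp: across_def a_def pos_less_divide_eq pos_divide_less_eq)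
    qed
    then have "(indicator S (x, z) :: real)
        = indicator {n..2 * n} x * indicator {a <..< a + 1 / sin \<alpha>} z" for z
      by (auto simp: S_def indicator_def)
    then show ?thesis using \<alpha> by simp
  qed
  have "(\<integral>p. indicator S p \<partial>lborel) = (\<integral>x. indicator {n..2 * n} x * (1 / sin \<alpha>) \<partial>lborel)"
    unfolding integral_plane_iterated(1)[OF int] inner by (rule refl)
  also have "\<dots> = n / sin \<alpha>" using n by simp
  finally show "(\<integral>p. indicator S p \<partial>lborel) = n / sin \<alpha>" .
qed

text \<open>
  Weyl's criterion, in the form that a resolvent estimate with constant \<open>C\<close> would bound the length \<open>n\<close>
  of the packets.
\<close>
lemma above_threshold_in_spectrum:
  assumes \<alpha>: "0 < sin \<alpha>"
  shows "complex_of_real (k\<^sup>2 + pi\<^sup>2) \<in> spectrum (V_waveguide \<alpha>) (Dirichlet_Laplacian (V_waveguide \<alpha>))"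
proof (rule ccontr)
  let ?\<Omega> = "V_waveguide \<alpha>"
  let ?z = "complex_of_real (k\<^sup>2 + pi\<^sup>2)"
  assume "?z \<notin> spectrum ?\<Omega> (Dirichlet_Laplacian ?\<Omega>)"
  then obtain C where C: "\<And>u f. (u, f) \<in> Dirichlet_Laplacian ?\<Omega> \<Longrightarrow>
      L2_norm ?\<Omega> u \<le> C * L2_norm ?\<Omega> (\<lambda>x. f x - ?z * u x)"
    unfolding spectrum_def resolvent_set_def by blast
  define g where "g n p = - (\<Sum>b\<in>Basis. partial b (partial b (wave_packet k \<alpha> n)) p)
      - ?z * wave_packet k \<alpha> n p" for n p
  obtain M where M: "M > 0" "\<And>n p. 1 \<le> n \<Longrightarrow> cmod (g n p) \<le> M / n"
    unfolding g_def by (rule wave_packet_residual_le) blast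
  obtain c where c: "c > 0" "\<And>n. 1 \<le> n \<Longrightarrow> c \<le> (L2_norm ?\<Omega> (wave_packet k \<alpha> n))\<^sup>2"
    by (rule wave_packet_norm_ge[OF \<alpha>]) blast
  have bound: "c * n \<le> C\<^sup>2 * M\<^sup>2 / sin \<alpha>" if n: "1 \<le> n" for n
  proof -
    have n0: "0 < n" using n by simp
    define S where "S = {p. n \<le> fst p \<and> fst p \<le> 2 * n \<and> 0 < across \<alpha> p \<and> across \<alpha> p < 1}"
    have cont: "continuous_on UNIV (g n)"
      unfolding g_def
      by (intro continuous_intros smooth_continuous smooth_partial smooth_wave_packet)
    have meas: "(\<lambda>p. (cmod (g n p))\<^sup>2) \<in> borel_measurable borel"
      by (intro borel_measurable_continuous_onI continuous_intros cont)
    have supp: "n \<le> fst p \<and> fst p \<le> 2 * n" if "g n p \<noteq> 0" for p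
    proof -
      have p0: "n \<le> fst q \<and> fst q \<le> 2 * n" if "wave_packet k \<alpha> n q \<noteq> 0" for q
        by (rule wave_packet_slab[OF n0 that])
      have p1: "n \<le> fst q \<and> fst q \<le> 2 * n" if "partial b (wave_packet k \<alpha> n) q \<noteq> 0" for b q
        by (rule partial_slab[OF _ that]) (rule p0)
      have p2: "n \<le> fst q \<and> fst q \<le> 2 * n"
        if "partial b (partial b (wave_packet k \<alpha> n)) q \<noteq> 0" for b q
        by (rule partial_slab[OF _ that]) (rule p1)
      show ?thesis
      proof (rule ccontr)
        assume out: "\<not> (n \<le> fst p \<and> fst p \<le> 2 * n)"
        then have "wave_packet k \<alpha> n p = 0" using p0 by blast
        moreover have "partial b (partial b (wave_packet k \<alpha> n)) p = 0" for b
        proof (rule ccontr)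
          assume "partial b (partial b (wave_packet k \<alpha> n)) p \<noteq> 0"
          from p2[OF this] out show False by contradiction
        qed
        ultimately show False using that by (simp add: g_def)
      qed
    qed
    have pt: "indicator ?\<Omega> p *\<^sub>R (cmod (g n p))\<^sup>2 \<le> (M / n)\<^sup>2 * indicator S p" for p
    proof (cases "p \<in> ?\<Omega> \<and> g n p \<noteq> 0")
      case True
      then have "p \<in> S"
        using supp[of p] n0 V_waveguide_right_branch[of p \<alpha>] by (auto simp: S_def)
      then show ?thesis using True M(2)[OF n, of p] by (simp add: power_mono)
    qed auto
    have "(L2_norm ?\<Omega> (g n))\<^sup>2 = (\<integral>p. indicator ?\<Omega> p *\<^sub>R (cmod (g n p))\<^sup>2 \<partial>lborel)"
      by (simp add: L2_norm_square integral_lebesgue_on_eq_lborel(1)[OF open_V_waveguide meas])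
    also have "\<dots> \<le> (\<integral>p. (M / n)\<^sup>2 * indicator S p \<partial>lborel)"
      using integral_slab(1)[OF \<alpha> n0, folded S_def]
      by (intro integral_mono' integrable_mult_right pt) auto
    also have "\<dots> = (M / n)\<^sup>2 * (n / sin \<alpha>)"
      using integral_slab(2)[OF \<alpha> n0, folded S_def] by simp
    finally have g: "(L2_norm ?\<Omega> (g n))\<^sup>2 \<le> (M / n)\<^sup>2 * (n / sin \<alpha>)" .
    have "L2_norm ?\<Omega> (wave_packet k \<alpha> n) \<le> C * L2_norm ?\<Omega> (g n)"
      unfolding g_def by (rule C[OF wave_packet_Dirichlet_Laplacian[OF \<alpha> n0]])
    then have "(L2_norm ?\<Omega> (wave_packet k \<alpha> n))\<^sup>2 \<le> (C * L2_norm ?\<Omega> (g n))\<^sup>2"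
      by (intro power_mono L2_norm_nonneg)
    also have "\<dots> \<le> C\<^sup>2 * ((M / n)\<^sup>2 * (n / sin \<alpha>))"
      unfolding power_mult_distrib by (intro mult_left_mono g) simp
    finally have "c \<le> C\<^sup>2 * ((M / n)\<^sup>2 * (n / sin \<alpha>))" using c(2)[OF n] by linarith
    then have "c * n \<le> C\<^sup>2 * ((M / n)\<^sup>2 * (n / sin \<alpha>)) * n" using n0 by (intro mult_right_mono) auto
    also have "\<dots> = C\<^sup>2 * M\<^sup>2 / sin \<alpha>" using n0 by (simp add: power2_eq_square field_simps)
    finally show ?thesis .
  qed
  define n where "n = max 1 (C\<^sup>2 * M\<^sup>2 / sin \<alpha> / c + 1)"
  have "C\<^sup>2 * M\<^sup>2 / sin \<alpha> / c < n" by (simp add: n_def less_max_iff_disj)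
  then have "C\<^sup>2 * M\<^sup>2 / sin \<alpha> < c * n" by (simp only: pos_divide_less_eq[OF c(1)] mult.commute)
  with bound[of n] show False by (simp add: n_def)
qed

text \<open>A point of the half-line \<open>[pi\<^sup>2, \<infinity>)\<close> is a limit of larger points of the spectrum.\<close>
lemma discrete_spectrum_less:
  assumes \<alpha>: "0 < sin \<alpha>"
    and l: "l \<in> discrete_spectrum (V_waveguide \<alpha>) (Dirichlet_Laplacian (V_waveguide \<alpha>))"
  shows "l < pi\<^sup>2"
proof (rule ccontr)
  let ?\<sigma> = "spectrum (V_waveguide \<alpha>) (Dirichlet_Laplacian (V_waveguide \<alpha>))"
  assume "\<not> l < pi\<^sup>2"
  then have ge: "pi\<^sup>2 \<le> l" by simp
  have "complex_of_real l isolated_in ?\<sigma>" using l by (simp add: discrete_spectrum_def)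
  then obtain e where e: "e > 0" "\<And>y. y \<in> ?\<sigma> \<Longrightarrow> dist (complex_of_real l) y < e \<Longrightarrow> y = complex_of_real l"
    unfolding isolated_in_dist_Ex_iff by blast
  define k where "k = sqrt (l + e / 2 - pi\<^sup>2)"
  have k: "k\<^sup>2 + pi\<^sup>2 = l + e / 2" using ge e(1) by (simp add: k_def)
  have "complex_of_real (l + e / 2) \<in> ?\<sigma>"
    using above_threshold_in_spectrum[OF \<alpha>, of k] unfolding k .
  moreover have "dist (complex_of_real l) (complex_of_real (l + e / 2)) < e"
    using e(1) by (simp add: dist_norm norm_divide)
  ultimately have "complex_of_real (l + e / 2) = complex_of_real l" by (rule e(2))
  then show False using e(1) by (simp only: of_real_eq_iff)
qed

theorem mainTheorem7:
  fixes lambda1 :: "real \<Rightarrow> real"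
  assumes "\<And>\<alpha>. \<alpha> \<in> {0<..<pi / 2} \<Longrightarrow>
    is_first_eigenvalue (V_waveguide \<alpha>) (Dirichlet_Laplacian (V_waveguide \<alpha>)) (lambda1 \<alpha>)"
  shows "(lambda1 \<longlongrightarrow> pi\<^sup>2) (at (pi / 2) within {0<..<pi / 2})"
proof (rule tendsto_sandwich)
  have \<alpha>: "pi\<^sup>2 * (sin \<alpha>)\<^sup>2 \<le> lambda1 \<alpha> \<and> lambda1 \<alpha> \<le> pi\<^sup>2" if "\<alpha> \<in> {0<..<pi / 2}" for \<alpha>
  proof
    have l: "lambda1 \<alpha> \<in> discrete_spectrum (V_waveguide \<alpha>) (Dirichlet_Laplacian (V_waveguide \<alpha>))"
      using assms[OF that] by (simp add: is_first_eigenvalue_def)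
    then show "pi\<^sup>2 * (sin \<alpha>)\<^sup>2 \<le> lambda1 \<alpha>"
      by (intro eigenvalue_ge that) (simp add: discrete_spectrum_def)
    have "0 < sin \<alpha>" using that by (intro sin_gt_zero) auto
    from discrete_spectrum_less[OF this l] show "lambda1 \<alpha> \<le> pi\<^sup>2" by simp
  qed
  show "\<forall>\<^sub>F \<alpha> in at (pi / 2) within {0<..<pi / 2}. pi\<^sup>2 * (sin \<alpha>)\<^sup>2 \<le> lambda1 \<alpha>"
    "\<forall>\<^sub>F \<alpha> in at (pi / 2) within {0<..<pi / 2}. lambda1 \<alpha> \<le> pi\<^sup>2"
    using \<alpha> by (simp_all add: eventually_at_filter)
  have "((\<lambda>\<alpha>. pi\<^sup>2 * (sin \<alpha>)\<^sup>2) \<longlongrightarrow> pi\<^sup>2 * (sin (pi / 2))\<^sup>2) (at (pi / 2) within {0<..<pi / 2})"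
    by (intro tendsto_intros)
  then show "((\<lambda>\<alpha>. pi\<^sup>2 * (sin \<alpha>)\<^sup>2) \<longlongrightarrow> pi\<^sup>2) (at (pi / 2) within {0<..<pi / 2})" by simp
qed (rule tendsto_const)

end
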